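(* Let $\varepsilon\in(0,2)$. Every 3-connected planar graph $G$ with average degree at least $4+\varepsilon$ contains a $K_4$-model with at most $2+\lceil 8/\varepsilon\rceil$ vertices.
   Context: Graphs are finite, simple and undirected; the average degree is $2|E(G)|/|V(G)|$. A $K_t$-model in $G$ consists of $t$ pairwise vertex-disjoint connected subgraphs $B_1,\dots,B_t$ (branch sets) such that for all distinct $i,j$ some vertex of $B_i$ is adjacent to some vertex of $B_j$; its number of vertices is $\sum_i|B_i|$. *)

theory Defs
  imports "HOL-Analysis.Analysis"
begin

record 'a ugraph =
  gverts :: "'a set"
  gedges :: "'a set set"

definition fin_simple_graph :: "'a ugraph \<Rightarrow> bool" where
  "fin_simple_graph G \<longleftrightarrow>
     finite (gverts G) \<and> (\<forall>e\<in>gedges G. e \<subseteq> gverts G \<and> card e = 2)"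

definition adj_rel :: "'a ugraph \<Rightarrow> ('a \<times> 'a) set" where
  "adj_rel G = {(u, v). {u, v} \<in> gedges G}"

definition avg_degree :: "'a ugraph \<Rightarrow> real" where
  "avg_degree G = 2 * real (card (gedges G)) / real (card (gverts G))"

definition is_subgraph :: "'a ugraph \<Rightarrow> 'a ugraph \<Rightarrow> bool" where
  "is_subgraph H G \<longleftrightarrow>
     fin_simple_graph H \<and> gverts H \<subseteq> gverts G \<and> gedges H \<subseteq> gedges G"

definition remove_verts :: "'a ugraph \<Rightarrow> 'a set \<Rightarrow> 'a ugraph" where
  "remove_verts G X =
     \<lparr>gverts = gverts G - X, gedges = {e \<in> gedges G. e \<inter> X = {}}\<rparr>"

(* The graph without vertices does not count as connected. *)
definition connected_graph :: "'a ugraph \<Rightarrow> bool" where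
  "connected_graph G \<longleftrightarrow>
     gverts G \<noteq> {} \<and> (\<forall>u\<in>gverts G. \<forall>v\<in>gverts G. (u, v) \<in> (adj_rel G)\<^sup>*)"

(* The usual vertex connectivity: more than k vertices, and no set of fewer than k
   vertices disconnects the graph. *)
definition k_connected :: "nat \<Rightarrow> 'a ugraph \<Rightarrow> bool" where
  "k_connected k G \<longleftrightarrow>
     card (gverts G) > k \<and>
     (\<forall>X\<subseteq>gverts G. card X < k \<longrightarrow> connected_graph (remove_verts G X))"

(* The plane is the type complex, the type used by the library's Jordan curve theorem.
   Vertices are drawn as distinct points and each edge as a simple arc joining the points
   of its two ends; an arc contains no other vertex point, and two arcs meet only
   in the points of common ends. *)
definition plane_drawing ::
  "'a ugraph \<Rightarrow> ('a \<Rightarrow> complex) \<Rightarrow> ('a set \<Rightarrow> real \<Rightarrow> complex) \<Rightarrow> bool" where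
  "plane_drawing G p \<gamma> \<longleftrightarrow>
     inj_on p (gverts G) \<and>
     (\<forall>e\<in>gedges G. arc (\<gamma> e) \<and> {pathstart (\<gamma> e), pathfinish (\<gamma> e)} = p ` e) \<and>
     (\<forall>e\<in>gedges G. path_image (\<gamma> e) \<inter> p ` gverts G = p ` e) \<and>
     (\<forall>e\<in>gedges G. \<forall>f\<in>gedges G. e \<noteq> f \<longrightarrow>
        path_image (\<gamma> e) \<inter> path_image (\<gamma> f) = p ` (e \<inter> f))"

definition planar_graph :: "'a ugraph \<Rightarrow> bool" where
  "planar_graph G \<longleftrightarrow> (\<exists>p \<gamma>. plane_drawing G p \<gamma>)"

(* The branch sets are B 0, ..., B (t - 1). *)
definition clique_model :: "nat \<Rightarrow> 'a ugraph \<Rightarrow> (nat \<Rightarrow> 'a ugraph) \<Rightarrow> bool" where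
  "clique_model t G B \<longleftrightarrow>
     (\<forall>i<t. is_subgraph (B i) G \<and> connected_graph (B i)) \<and>
     (\<forall>i<t. \<forall>j<t. i \<noteq> j \<longrightarrow>
        gverts (B i) \<inter> gverts (B j) = {} \<and>
        (\<exists>u\<in>gverts (B i). \<exists>v\<in>gverts (B j). (u, v) \<in> adj_rel G))"

definition model_size :: "nat \<Rightarrow> (nat \<Rightarrow> 'a ugraph) \<Rightarrow> nat" where
  "model_size t B = (\<Sum>i<t. card (gverts (B i)))"

end

theory Submission
  imports Defs
begin

text \<open>Call an induced cycle with connected complement a face. Tutte's theorem says that in a 3-connected
  graph the faces generate the cycle space. It is used in dual form: an edge set that meets every face
  in an even number of edges is a cut. Hence there are at least |E| - |V| + 1 faces, which replaces
  Euler's formula, and every edge lies on at least two faces. Planarity enters only through the Jordan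
  curve theorem, which shows that no edge lies on three faces. Two faces meet in nothing, a vertex or
  an edge, so the faces around a vertex v form a wheel with hub v, which contains a K4-model with at
  most 1 plus the sum of (|S| - 2) vertices, where S ranges over the faces at v. If this were large at
  every vertex, then bounding the sum of 1/|S| at each vertex would give too few faces.\<close>

section \<open>Walks and their parity\<close>

text \<open>An edge set \<open>K\<close> is read as a signature: every walk carries the parity of
  its \<open>K\<close>-edges. A cut is then exactly a \<open>K\<close> for which all closed walks
  are even, so cycle space and duality need no vector space of their own. The counts need opposite
  bounds. The lower bound on the number of faces comes from rank and nullity over GF(2): the kernel
  consists of cuts, of which there are at most 2^(n-1). The upper bound on the faces at an edge
  comes from topology. Topological faces are never counted. Origin of the constant: let m = |E|, n =
  |V|, and suppose that the rim bound, the sum of |S| - 2, is at least \<open>D\<close> at every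
  vertex. Charging 1/|S| to each vertex of a face gives at most 2m(D+1)/(3D) - n/3 faces, and
  comparing with m - n + 1 yields m(D-2) < 2Dn. With m \<ge> (2 + \<epsilon>/2)n and D = T + 2 this
  says \<epsilon>T < 8, which T = \<lceil>8/\<epsilon>\<rceil> excludes. So some rim bound is at
  most T + 1, and the hub makes T + 2.\<close>

fun wpar :: "'a set set \<Rightarrow> 'a list \<Rightarrow> bool" where
  "wpar K (x # y # zs) = (({x, y} \<in> K) \<noteq> wpar K (y # zs))"
| "wpar K _ = False"

text \<open>Repetitions are lost here, whereas \<open>wpar\<close> counts them; on lists of distinct
  vertices the two agree.\<close>

fun ledges :: "'a list \<Rightarrow> 'a set set" where
  "ledges (x # y # zs) = insert {x, y} (ledges (y # zs))"
| "ledges _ = {}"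

lemma wpar_append: "wpar K (xs @ y # zs) = (wpar K (xs @ [y]) \<noteq> wpar K (y # zs))"
  by (induction K xs rule: wpar.induct) (cases zs; auto)+

lemma ledges_append: "ledges (xs @ y # zs) = ledges (xs @ [y]) \<union> ledges (y # zs)"
  by (induction xs rule: ledges.induct) (cases zs; auto)+

lemma wpar_rev: "wpar K (rev xs) = wpar K xs"
proof (induction K xs rule: wpar.induct)
  case (1 K x y zs)
  have "wpar K (rev zs @ y # [x]) = (wpar K (rev zs @ [y]) \<noteq> wpar K [y, x])"
    by (rule wpar_append)
  with 1 show ?case by (auto simp: insert_commute)
qed auto

lemma finite_ledges: "finite (ledges xs)"
  by (induction xs rule: ledges.induct) auto

lemma ledges_subset: "e \<in> ledges xs \<Longrightarrow> e \<subseteq> set xs"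
  by (induction xs rule: ledges.induct) auto

lemma wpar_eq_odd_card:
  "distinct xs \<Longrightarrow> wpar K xs \<longleftrightarrow> odd (card (K \<inter> ledges xs))"
proof (induction K xs rule: wpar.induct)
  case (1 K x y zs)
  have "{x, y} \<notin> ledges (y # zs)"
    using 1(2) ledges_subset by fastforce
  then show ?case using 1 finite_ledges[of "y # zs"] by (auto simp: Int_insert_right)
qed auto

text \<open>Length at least 3 makes the closing edge a new one: closing up \<open>[x, y]\<close>
  would run through a single edge twice.\<close>

lemma wpar_cycle_eq_odd_card:
  assumes "distinct c" "length c \<ge> 3"
  shows "wpar K (c @ [hd c]) \<longleftrightarrow> odd (card (K \<inter> ledges (c @ [hd c])))"
proof -
  obtain x y m z where c: "c = x # y # m @ [z]"
  proof -
    obtain x y r where "c = x # y # r" "r \<noteq> []"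
      using assms(2) by (cases c; cases "tl c"; cases "tl (tl c)") auto
    then show ?thesis using that[of x y "butlast r" "last r"] by simp
  qed
  have w: "wpar K (c @ [hd c]) = (wpar K c \<noteq> ({z, x} \<in> K))"
    using wpar_append[of K "x # y # m" z "[x]"] by (simp add: c)
  have l: "ledges (c @ [hd c]) = insert {z, x} (ledges c)"
    using ledges_append[of "x # y # m" z "[x]"] by (simp add: c)
  have "{z, x} \<notin> ledges (y # m @ [z])"
    using ledges_subset assms(1) c by fastforce
  then have "{z, x} \<notin> ledges c"
    using assms(1) by (auto simp: c doubleton_eq_iff)
  then show ?thesis
    using wpar_eq_odd_card[OF assms(1), of K] w l finite_ledges[of c]
    by (auto simp: Int_insert_right)
qed

section \<open>Signed walks and balance in finite simple graphs\<close>

locale sgraph =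
  fixes V :: "'a set" and E :: "'a set set"
  assumes finV: "finite V"
    and edge: "\<And>e. e \<in> E \<Longrightarrow> e \<subseteq> V \<and> card e = 2"
begin

abbreviation adj :: "'a \<Rightarrow> 'a \<Rightarrow> bool" where "adj u v \<equiv> {u, v} \<in> E"

lemma adj_sym: "adj u v \<Longrightarrow> adj v u"
  by (simp add: insert_commute)

lemma adjD: "adj u v \<Longrightarrow> u \<in> V \<and> v \<in> V \<and> u \<noteq> v"
  using edge[of "{u, v}"] by auto

lemma no_loop [simp]: "{v} \<notin> E"
  using edge[of "{v}"] by auto

lemma edgeE:
  assumes "e \<in> E"
  obtains u v where "e = {u, v}" "u \<noteq> v" "adj u v"
  using edge[OF assms] assms by (auto simp: card_2_iff)

lemma finE: "finite E"
proof -
  have "E \<subseteq> Pow V" using edge by auto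
  then show ?thesis using finV finite_subset by blast
qed

definition adj_in :: "'a set \<Rightarrow> ('a \<times> 'a) set" where
  "adj_in A = {(u, v). u \<in> A \<and> v \<in> A \<and> adj u v}"

definition conn :: "'a set \<Rightarrow> bool" where
  "conn A \<longleftrightarrow> A \<noteq> {} \<and> (\<forall>u\<in>A. \<forall>v\<in>A. (u, v) \<in> (adj_in A)\<^sup>*)"

definition nbrs :: "'a \<Rightarrow> 'a set" where
  "nbrs v = {u. adj v u}"

lemma nbrs_subset: "nbrs v \<subseteq> V" "v \<notin> nbrs v" "finite (nbrs v)"
proof -
  show "nbrs v \<subseteq> V" using adjD by (auto simp: nbrs_def)
  then show "finite (nbrs v)" using finV finite_subset by blast
  show "v \<notin> nbrs v" by (simp add: nbrs_def)
qed

lemma sym_adj_in: "sym (adj_in A)"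
  by (auto simp: sym_def adj_in_def insert_commute)

lemma adj_in_rtrancl_sym: "(u, v) \<in> (adj_in A)\<^sup>* \<Longrightarrow> (v, u) \<in> (adj_in A)\<^sup>*"
  by (rule symD[OF sym_rtrancl[OF sym_adj_in]])

lemma adj_in_mono: "A \<subseteq> B \<Longrightarrow> (adj_in A)\<^sup>* \<subseteq> (adj_in B)\<^sup>*"
  by (rule rtrancl_mono) (auto simp: adj_in_def)

lemma adj_in_stays: "(u, v) \<in> (adj_in A)\<^sup>* \<Longrightarrow> u \<in> A \<Longrightarrow> v \<in> A"
  by (induction rule: rtrancl_induct) (auto simp: adj_in_def)

lemma conn_singleton: "conn {x}"
  by (simp add: conn_def)

lemma connI_root:
  assumes "r \<in> A" "\<And>x. x \<in> A \<Longrightarrow> (r, x) \<in> (adj_in A)\<^sup>*"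
  shows "conn A"
  unfolding conn_def using assms adj_in_rtrancl_sym rtrancl_trans by (metis empty_iff)

lemma conn_Un:
  assumes "conn A" "conn B" "a \<in> A" "b \<in> B" "a = b \<or> adj a b"
  shows "conn (A \<union> B)"
proof (rule connI_root[of a])
  show "a \<in> A \<union> B" using assms by simp
  fix x assume "x \<in> A \<union> B"
  then consider "x \<in> A" | "x \<in> B" by blast
  then show "(a, x) \<in> (adj_in (A \<union> B))\<^sup>*"
  proof cases
    case 1
    then have "(a, x) \<in> (adj_in A)\<^sup>*" using assms by (simp add: conn_def)
    then show ?thesis using adj_in_mono[of A "A \<union> B"] by auto
  next
    case 2
    then have "(b, x) \<in> (adj_in B)\<^sup>*" using assms by (simp add: conn_def)
    then have *: "(b, x) \<in> (adj_in (A \<union> B))\<^sup>*" using adj_in_mono[of B "A \<union> B"] by auto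
    have "(a, b) \<in> (adj_in (A \<union> B))\<^sup>*" using assms(3-5) by (auto simp: adj_in_def)
    then show ?thesis using * by (rule rtrancl_trans)
  qed
qed

lemma conn_insert: "conn B \<Longrightarrow> b \<in> B \<Longrightarrow> adj x b \<Longrightarrow> conn (insert x B)"
  using conn_Un[OF conn_singleton, of B x x b] by simp

text \<open>A walk inside \<open>A\<close> from \<open>I\<close> to its outside has a step that
  leaves \<open>I\<close>. Connectivity of a graph minus a few vertices is mostly exploited in this
  form, with \<open>I\<close> the part that those vertices would cut off.\<close>

lemma conn_cross:
  assumes "conn A" "u \<in> A" "u \<in> I" "v \<in> A" "v \<notin> I"
  shows "\<exists>s t. s \<in> A \<inter> I \<and> t \<in> A - I \<and> adj s t"
proof (rule ccontr)
  assume no: "\<not> ?thesis"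
  have "(u, v) \<in> (adj_in A)\<^sup>*" using assms by (simp add: conn_def)
  then have "v \<in> A \<inter> I"
  proof (induction rule: rtrancl_induct)
    case base show ?case using assms by simp
  next
    case (step y z)
    then show ?case using no by (auto simp: adj_in_def)
  qed
  then show False using assms by simp
qed

lemma conn_list: "successively adj xs \<Longrightarrow> xs \<noteq> [] \<Longrightarrow> conn (set xs)"
proof (induction xs rule: induct_list012)
  case (3 x y zs)
  then show ?case using conn_insert[of "set (y # zs)" y x] by simp
qed (auto simp: conn_singleton)

text \<open>Walks rather than paths, so that concatenation needs no disjointness. The parity is an
  argument because the proofs compare two walks with the same ends.\<close>

definition pw :: "'a set set \<Rightarrow> 'a set \<Rightarrow> 'a \<Rightarrow> 'a \<Rightarrow> bool \<Rightarrow> bool" where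
  "pw K A u v b \<longleftrightarrow> (\<exists>xs. xs \<noteq> [] \<and> successively adj xs \<and> set xs \<subseteq> A \<and>
     hd xs = u \<and> last xs = v \<and> wpar K xs = b)"

text \<open>With the edges in \<open>K\<close> as the negative ones, this is the failure of balance
  for the signed graph induced on \<open>A\<close>.\<close>

definition unbalanced :: "'a set set \<Rightarrow> 'a set \<Rightarrow> bool" where
  "unbalanced K A \<longleftrightarrow> (\<exists>u. pw K A u u True)"

lemma pw_mono: "pw K A u v b \<Longrightarrow> A \<subseteq> B \<Longrightarrow> pw K B u v b"
  unfolding pw_def by blast

lemma unbalanced_mono: "unbalanced K A \<Longrightarrow> A \<subseteq> B \<Longrightarrow> unbalanced K B"
  unfolding unbalanced_def using pw_mono by blast

lemma pw_refl: "u \<in> A \<Longrightarrow> pw K A u u False"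
  unfolding pw_def by (rule exI[of _ "[u]"]) auto

lemma pw_edge: "adj u v \<Longrightarrow> u \<in> A \<Longrightarrow> v \<in> A \<Longrightarrow> pw K A u v ({u, v} \<in> K)"
  unfolding pw_def by (rule exI[of _ "[u, v]"]) auto

lemma pw_list:
  "xs \<noteq> [] \<Longrightarrow> successively adj xs \<Longrightarrow> set xs \<subseteq> A \<Longrightarrow> pw K A (hd xs) (last xs) (wpar K xs)"
  unfolding pw_def by blast

lemma pw_sym: "pw K A u v b \<Longrightarrow> pw K A v u b"
proof -
  assume "pw K A u v b"
  then obtain xs where xs: "xs \<noteq> []" "successively adj xs" "set xs \<subseteq> A"
    "hd xs = u" "last xs = v" "wpar K xs = b"
    unfolding pw_def by blast
  have "successively adj (rev xs)"
    using xs(2) by (auto simp: insert_commute)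
  then show ?thesis unfolding pw_def
    using xs by (intro exI[of _ "rev xs"]) (auto simp: wpar_rev hd_rev last_rev)
qed

lemma pw_trans:
  assumes "pw K A u v b" "pw K A v w c"
  shows "pw K A u w (b \<noteq> c)"
proof -
  obtain xs where xs: "xs \<noteq> []" "successively adj xs" "set xs \<subseteq> A"
    "hd xs = u" "last xs = v" "wpar K xs = b"
    using assms(1) unfolding pw_def by blast
  obtain ys where ys: "ys \<noteq> []" "successively adj ys" "set ys \<subseteq> A"
    "hd ys = v" "last ys = w" "wpar K ys = c"
    using assms(2) unfolding pw_def by blast
  obtain xs' where x: "xs = xs' @ [v]" using xs by (metis append_butlast_last_id)
  obtain ys' where y: "ys = v # ys'" using ys by (cases ys) auto
  have "successively adj (xs' @ v # ys')"
    using xs(2) ys(2) unfolding x y by (auto simp: successively_append_iff)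
  moreover have "wpar K (xs' @ v # ys') = (b \<noteq> c)"
    using wpar_append[of K xs' v ys'] xs(6) ys(6) x y by simp
  ultimately show ?thesis
    unfolding pw_def using xs ys x y
    by (intro exI[of _ "xs' @ v # ys'"]) (auto simp: hd_append)
qed

lemma pw_rtrancl:
  assumes "(u, v) \<in> (adj_in A)\<^sup>*" "u \<in> A"
  shows "\<exists>b. pw K A u v b"
  using assms(1)
proof (induction rule: rtrancl_induct)
  case base then show ?case using pw_refl assms(2) by blast
next
  case (step y z)
  then show ?case using pw_trans pw_edge unfolding adj_in_def by blast
qed

lemma unbalancedI: "pw K A u v a \<Longrightarrow> pw K A u v b \<Longrightarrow> a \<noteq> b \<Longrightarrow> unbalanced K A"
  unfolding unbalanced_def using pw_trans[of K A u v a u b] pw_sym by auto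

definition cyc :: "'a list \<Rightarrow> bool" where
  "cyc c \<longleftrightarrow> distinct c \<and> length c \<ge> 3 \<and> successively adj (c @ [hd c])"

lemma cyc_rotate: "cyc (a @ b) \<Longrightarrow> cyc (b @ a)"
  unfolding cyc_def
  by (cases a; cases b) (auto simp: successively_append_iff successively_Cons hd_append split: if_splits)

lemma wpar_rotate: "wpar K ((a @ b) @ [hd (a @ b)]) = wpar K ((b @ a) @ [hd (b @ a)])"
proof (cases "a = [] \<or> b = []")
  case False
  then obtain x a' y b' where "a = x # a'" "b = y # b'" by (metis list.exhaust)
  then show ?thesis
    using wpar_append[of K a y "b' @ [x]"] wpar_append[of K b x "a' @ [y]"] by auto
qed auto

lemma ledges_rotate: "ledges ((a @ b) @ [hd (a @ b)]) = ledges ((b @ a) @ [hd (b @ a)])"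
proof (cases "a = [] \<or> b = []")
  case False
  then obtain x a' y b' where "a = x # a'" "b = y # b'" by (metis list.exhaust)
  then show ?thesis
    using ledges_append[of a y "b' @ [x]"] ledges_append[of b x "a' @ [y]"] by auto
qed auto

text \<open>At a repeated vertex a closed walk splits into two shorter closed walks whose parities
  add up to the old one, so one of them is again odd.\<close>

lemma unbalanced_cyc:
  assumes "unbalanced K A"
  obtains c where "cyc c" "set c \<subseteq> A" "wpar K (c @ [hd c])"
proof -
  have "\<exists>c. cyc c \<and> set c \<subseteq> A \<and> wpar K (c @ [hd c])"
    if "successively adj (c @ [hd c])" "c \<noteq> []" "set c \<subseteq> A" "wpar K (c @ [hd c])" for c
    using that
  proof (induction c rule: length_induct)
    case (1 c)
    show ?case
    proof (cases "distinct c")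
      case True
      \<comment> \<open>A single vertex would need a loop, and the walk x, y, x uses its edge twice
        and is even.\<close>
      have "length c \<ge> 3"
      proof (rule ccontr)
        assume "\<not> 3 \<le> length c"
        then consider x where "c = [x]" | x y where "c = [x, y]"
          using 1(3) by (cases c; cases "tl c"; cases "tl (tl c)") auto
        then show False using 1(5) 1(2)
          by cases (auto simp: insert_commute)
      qed
      then show ?thesis using True 1 by (auto simp: cyc_def)
    next
      case False
      then obtain c1 z c2 c3 where c: "c = c1 @ [z] @ c2 @ [z] @ c3"
        using not_distinct_decomp by blast
      define h where "h = hd c"
      have full: "c @ [h] = c1 @ z # c2 @ z # c3 @ [h]" using c by simp
      have s: "successively adj (c1 @ z # c2 @ z # c3 @ [h])"
        using 1(2) full h_def by simp
      let ?d = "z # c2" and ?e = "c1 @ z # c3"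
      have he: "hd ?e = h" using c h_def by (cases c1) auto
      have w: "wpar K (c @ [h]) = (wpar K (?d @ [z]) \<noteq> wpar K (?e @ [h]))"
        using wpar_append[of K c1 z "c2 @ z # c3 @ [h]"] wpar_append[of K "z # c2" z "c3 @ [h]"]
          wpar_append[of K c1 z "c3 @ [h]"] full by auto
      have sd: "successively adj (?d @ [hd ?d])" and se: "successively adj (?e @ [hd ?e])"
        using s unfolding he by (auto simp: successively_append_iff successively_Cons hd_append split: if_splits)
      show ?thesis
      proof (cases "wpar K (?d @ [z])")
        case True
        then show ?thesis using 1(1)[rule_format, of ?d] sd 1(4) c by auto
      next
        case False
        then have "wpar K (?e @ [hd ?e])" using w 1(5) he h_def by auto
        then show ?thesis using 1(1)[rule_format, of ?e] se 1(4) c by auto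
      qed
    qed
  qed
  note main = this
  obtain u xs where xs: "xs \<noteq> []" "successively adj xs" "set xs \<subseteq> A"
    "hd xs = u" "last xs = u" "wpar K xs"
    using assms unfolding unbalanced_def pw_def by auto
  obtain ys where y: "xs = ys @ [u]" using xs by (metis append_butlast_last_id)
  have "ys \<noteq> []" using xs(6) y by auto
  then have "hd ys = u" using xs(4) y by auto
  then show ?thesis using main[of ys] xs y \<open>ys \<noteq> []\<close> that by auto
qed

lemma cyc_unbalanced: "cyc c \<Longrightarrow> wpar K (c @ [hd c]) \<Longrightarrow> unbalanced K (set c)"
  unfolding unbalanced_def cyc_def
  by (rule exI[of _ "hd c"])
    (use pw_list[of "c @ [hd c]" "set c" K] in \<open>cases c; auto\<close>)

text \<open>Harary's theorem on signed graphs. Fix a root and let \<open>Y\<close> be the vertices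
  reached from it by odd walks; balance makes the parity independent of the walk, and it flips
  exactly along the edges of \<open>K\<close>.\<close>

lemma balanced_cut:
  assumes "conn A" "\<not> unbalanced K A"
  obtains Y where "\<And>u v. u \<in> A \<Longrightarrow> v \<in> A \<Longrightarrow> adj u v \<Longrightarrow> {u, v} \<in> K \<longleftrightarrow> (u \<in> Y) \<noteq> (v \<in> Y)"
proof -
  obtain r where r: "r \<in> A" using assms by (auto simp: conn_def)
  have ex: "\<exists>b. pw K A r u b" if "u \<in> A" for u
    using pw_rtrancl[of r u A K] r that assms(1) by (auto simp: conn_def)
  have uniq: "b = b'" if "pw K A r u b" "pw K A r u b'" for u b b'
    using unbalancedI that assms(2) by blast
  show ?thesis
  proof (rule that[of "{u. pw K A r u True}"])
    fix u v assume uv: "u \<in> A" "v \<in> A" "adj u v"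
    obtain b where b: "pw K A r u b" using ex uv by blast
    have "pw K A r v (b \<noteq> ({u, v} \<in> K))" using pw_trans[OF b pw_edge[OF uv(3,1,2)]] .
    then show "{u, v} \<in> K \<longleftrightarrow> (u \<in> {u. pw K A r u True}) \<noteq> (v \<in> {u. pw K A r u True})"
      using b uniq by (auto) (metis (full_types))+
  qed
qed

section \<open>Rotation and splitting of cycles; minimal odd cycles\<close>

lemma cyc_split:
  assumes "cyc (x # a @ y # b)"
  shows "successively adj (x # a @ [y])" "successively adj (y # b @ [x])"
    "wpar K ((x # a @ y # b) @ [hd (x # a @ y # b)]) = (wpar K (x # a @ [y]) \<noteq> wpar K (y # b @ [x]))"
proof -
  have "successively adj ((x # a) @ y # b @ [x])" using assms by (simp add: cyc_def)
  then show "successively adj (x # a @ [y])" "successively adj (y # b @ [x])"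
    by (auto simp: successively_append_iff successively_Cons hd_append split: if_splits)
  show "wpar K ((x # a @ y # b) @ [hd (x # a @ y # b)]) = (wpar K (x # a @ [y]) \<noteq> wpar K (y # b @ [x]))"
    using wpar_append[of K "x # a" y "b @ [x]"] by simp
qed

text \<open>Cycles are lists with an arbitrary starting point. This rotation puts a given vertex
  first and exposes both its neighbours on the cycle.\<close>

lemma cyc_at:
  assumes "cyc c" "v \<in> set c"
  obtains u w y m z where "c = u @ w" "w @ u = v # y # m @ [z]"
proof -
  obtain u w where c: "c = u @ v # w" using assms(2) split_list by metis
  have "length (w @ u) \<ge> 2" using assms(1) c by (auto simp: cyc_def)
  then obtain y r where r: "w @ u = y # r" "r \<noteq> []"
    by (cases "w @ u"; cases "tl (w @ u)") auto
  then have "(v # w) @ u = v # y # butlast r @ [last r]" by simp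
  then show ?thesis using that c by blast
qed

lemma cyc_nbrs:
  assumes "cyc (v # y # m @ [z])"
  shows "adj v y" "adj z v" "y \<noteq> z"
  using assms by (auto simp: cyc_def successively_append_iff successively_Cons split: if_splits)

text \<open>Minimality is by vertex set and against odd closed walks, so that it can be contradicted
  without first extracting a cycle from the walk.\<close>

definition min_odd_cyc :: "'a set set \<Rightarrow> 'a list \<Rightarrow> bool" where
  "min_odd_cyc K c \<longleftrightarrow> cyc c \<and> wpar K (c @ [hd c]) \<and> (\<forall>A'. A' \<subset> set c \<longrightarrow> \<not> unbalanced K A')"

lemma unbalanced_min_odd_cyc:
  assumes "unbalanced K A0" "finite A0"
  obtains c where "min_odd_cyc K c" "set c \<subseteq> A0"
proof -
  have fin: "finite {A. A \<subseteq> A0 \<and> unbalanced K A}"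
    using assms(2) by (rule_tac finite_subset[of _ "Pow A0"]) auto
  obtain A where A: "A \<in> {A. A \<subseteq> A0 \<and> unbalanced K A}"
    and m: "\<And>b. b \<in> {A. A \<subseteq> A0 \<and> unbalanced K A} \<Longrightarrow> b \<le> A \<Longrightarrow> A = b"
    using finite_has_minimal2[OF fin, of A0] assms(1) by (metis (mono_tags) mem_Collect_eq order_refl)
  obtain c where c: "cyc c" "set c \<subseteq> A" "wpar K (c @ [hd c])"
    using A unbalanced_cyc by blast
  have "unbalanced K (set c)" using cyc_unbalanced c by blast
  then have "set c = A" using m[of "set c"] A c(2) by auto
  then have "min_odd_cyc K c" unfolding min_odd_cyc_def using c m A by blast
  then show ?thesis using that c(2) A by blast
qed

lemma min_odd_cyc_rotate: "min_odd_cyc K (u @ w) \<Longrightarrow> min_odd_cyc K (w @ u)"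
  unfolding min_odd_cyc_def
  using cyc_rotate[of u w] wpar_rotate[of K u w] by (simp add: Un_commute)

text \<open>The chord closes up both arcs. As the cycle is odd, exactly one of the two closed walks
  is odd, and it misses the interior vertices of the other arc.\<close>

lemma min_odd_cyc_chordless:
  assumes "min_odd_cyc K (x # a @ y # b)" "a \<noteq> []" "b \<noteq> []"
  shows "\<not> adj x y"
proof
  assume xy: "adj x y"
  let ?c = "x # a @ y # b"
  have c: "cyc ?c" and m: "\<And>A'. A' \<subset> set ?c \<Longrightarrow> \<not> unbalanced K A'"
    using assms(1) by (auto simp: min_odd_cyc_def)
  have d: "distinct ?c" using c by (simp add: cyc_def)
  have p1: "pw K (set (x # a @ [y])) x y (wpar K (x # a @ [y]))"
    using pw_list[of "x # a @ [y]" "set (x # a @ [y])" K] cyc_split(1)[OF c] by simp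
  have p2: "pw K (set (y # b @ [x])) y x (wpar K (y # b @ [x]))"
    using pw_list[of "y # b @ [x]" "set (y # b @ [x])" K] cyc_split(2)[OF c] by simp
  have e: "pw K (set (x # a @ [y])) x y ({x, y} \<in> K)" "pw K (set (y # b @ [x])) x y ({x, y} \<in> K)"
    using pw_edge[OF xy] by simp_all
  have "wpar K (x # a @ [y]) \<noteq> wpar K (y # b @ [x])"
    using assms(1) cyc_split(3)[OF c, of K] unfolding min_odd_cyc_def by blast
  then have "unbalanced K (set (x # a @ [y])) \<or> unbalanced K (set (y # b @ [x]))"
    using unbalancedI[OF p1 e(1)] unbalancedI[OF pw_sym[OF p2] e(2)] by blast
  moreover have "set (x # a @ [y]) \<subset> set ?c" "set (y # b @ [x]) \<subset> set ?c"
    using assms(2,3) d by (cases a; cases b; auto)+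
  ultimately show False using m by blast
qed

lemma min_odd_cyc_induced:
  assumes "min_odd_cyc K c" "v \<in> set c"
  shows "card (nbrs v \<inter> set c) = 2"
proof -
  obtain u w y m z where *: "c = u @ w" "w @ u = v # y # m @ [z]"
    using cyc_at assms unfolding min_odd_cyc_def by metis
  have mo: "min_odd_cyc K (v # y # m @ [z])"
    using min_odd_cyc_rotate[of K u w] assms(1) * by simp
  then have "cyc (v # y # m @ [z])" by (simp add: min_odd_cyc_def)
  note yz = cyc_nbrs[OF this]
  have no: "\<not> adj v t" if "t \<in> set m" for t
  proof -
    obtain m1 m2 where "m = m1 @ t # m2" using split_list[OF \<open>t \<in> set m\<close>] by blast
    then have "min_odd_cyc K (v # (y # m1) @ t # m2 @ [z])" using mo by simp
    from min_odd_cyc_chordless[OF this] show ?thesis by simp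
  qed
  have "set c = set (w @ u)" using *(1) by auto
  then have "set c = {v, y, z} \<union> set m" unfolding *(2) by auto
  then have "nbrs v \<inter> set c = {y, z}"
    using yz no adj_sym[of z v] by (auto simp: nbrs_def)
  then show ?thesis using yz by simp
qed

text \<open>Faces are the induced cycles with connected complement. Being chordless, such a cycle is determined
  by its vertex set, which is what represents it here.\<close>

definition face :: "'a set \<Rightarrow> bool" where
  "face S \<longleftrightarrow> (\<exists>c. cyc c \<and> set c = S) \<and> (\<forall>v\<in>S. card (nbrs v \<inter> S) = 2) \<and> conn (V - S)"

lemma induced_cyc_at:
  assumes "cyc c" "v \<in> set c" "card (nbrs v \<inter> set c) = 2"
  obtains u w y m z where "c = u @ w" "w @ u = v # y # m @ [z]" "cyc (v # y # m @ [z])"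
    "set c = {v, y, z} \<union> set m" "nbrs v \<inter> set c = {y, z}" "y \<noteq> z"
proof -
  obtain u w y m z where uw: "c = u @ w" "w @ u = v # y # m @ [z]"
    using cyc_at[OF assms(1,2)] by metis
  have cy: "cyc (v # y # m @ [z])" using cyc_rotate[of u w] assms(1) uw by simp
  note yz = cyc_nbrs[OF cy]
  have "set c = set (w @ u)" using uw(1) by auto
  then have sc: "set c = {v, y, z} \<union> set m" unfolding uw(2) by auto
  have "{y, z} = nbrs v \<inter> set c"
  proof (rule card_subset_eq)
    show "finite (nbrs v \<inter> set c)" by simp
    show "{y, z} \<subseteq> nbrs v \<inter> set c" using yz adj_sym[of z v] sc by (auto simp: nbrs_def)
    show "card {y, z} = card (nbrs v \<inter> set c)" using yz assms(3) by simp
  qed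
  then show ?thesis using that[of u w y m z] uw cy sc yz by simp
qed

lemma face_facts:
  assumes "face S"
  shows "S \<subseteq> V" "finite S" "card S \<ge> 3"
proof -
  obtain c where c: "cyc c" "set c = S" using assms by (auto simp: face_def)
  show "finite S" using c by auto
  show "card S \<ge> 3" using c distinct_card[of c] by (auto simp: cyc_def)
  show "S \<subseteq> V"
  proof
    fix x assume x: "x \<in> S"
    then have "card (nbrs x \<inter> S) = 2" using assms by (simp add: face_def)
    then have "nbrs x \<inter> S \<noteq> {}" by auto
    then show "x \<in> V" using adjD by (auto simp: nbrs_def)
  qed
qed

end

section \<open>Odd faces in 3-connected graphs\<close>

locale three_connected = sgraph +
  assumes conn3: "\<And>X. X \<subseteq> V \<Longrightarrow> card X < 3 \<Longrightarrow> conn (V - X)"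
    and cardV: "card V > 3"
begin

lemma card_nbrs_ge_3:
  assumes "v \<in> V"
  shows "card (nbrs v) \<ge> 3"
proof (rule ccontr)
  assume "\<not> ?thesis"
  then have c: "card (nbrs v) < 3" by simp
  have cn: "conn (V - nbrs v)" using conn3[OF nbrs_subset(1) c] .
  have "card (insert v (nbrs v)) < card V"
    using c cardV nbrs_subset[of v] by simp
  moreover have "insert v (nbrs v) \<subseteq> V" using nbrs_subset assms by auto
  ultimately obtain w where w: "w \<in> V" "w \<notin> insert v (nbrs v)"
    by (metis nat_neq_iff subsetI subset_antisym)
  have "\<exists>s t. s \<in> (V - nbrs v) \<inter> {v} \<and> t \<in> (V - nbrs v) - {v} \<and> adj s t"
    using conn_cross[OF cn, of v "{v}" w] w assms nbrs_subset(2)[of v] by auto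
  then show False by (auto simp: nbrs_def)
qed

text \<open>This is the dual form of Tutte's theorem that the faces generate the cycle space. Enlarge B0 to a
  maximal connected set B whose complement is still unbalanced and take a minimal odd cycle c there.
  If some vertices W lay outside both, a walk through W between two vertices of c that separate the
  attachments of B would split c into two closed walks; one of them is odd and misses a larger
  connected set than B.\<close>

lemma odd_face_avoiding:
  assumes "conn B0" "B0 \<subseteq> V" "unbalanced K (V - B0)"
  obtains c where "cyc c" "wpar K (c @ [hd c])" "face (set c)" "set c \<inter> B0 = {}"
proof -
  let ?F = "{B. B0 \<subseteq> B \<and> B \<subseteq> V \<and> conn B \<and> unbalanced K (V - B)}"
  have fin: "finite ?F" using finV by (rule_tac finite_subset[of _ "Pow V"]) auto
  obtain B where B: "B0 \<subseteq> B" "B \<subseteq> V" "conn B" "unbalanced K (V - B)"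
    and max: "\<And>B'. B' \<in> ?F \<Longrightarrow> B \<subseteq> B' \<Longrightarrow> B = B'"
    using finite_has_maximal2[OF fin, of B0] assms by (smt (verit) mem_Collect_eq order_refl)
  obtain c where c: "min_odd_cyc K c" "set c \<subseteq> V - B"
    using unbalanced_min_odd_cyc B(4) finV by blast
  define A where "A = set c"
  define W where "W = V - A - B"
  define N where "N = {s \<in> A. \<exists>b\<in>B. adj s b}"
  \<comment> \<open>\<open>P\<close> is invariant under rotation, so each argument may start the
    list at its favourite vertex.\<close>
  define P where "P c' \<longleftrightarrow> min_odd_cyc K c' \<and> set c' = A" for c'
  have Pc: "P c" using c by (simp add: P_def A_def)
  have AB: "A \<subseteq> V" "A \<inter> B = {}" using c by (auto simp: A_def)
  have finA: "finite A" by (simp add: A_def)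
  have oddA: "unbalanced K A"
    using c cyc_unbalanced unfolding A_def min_odd_cyc_def by blast
  have rot: "P (w @ u)" if "P (u @ w)" for u w
    using that min_odd_cyc_rotate[of K u w] by (auto simp: P_def)
  have Pd: "distinct c'" "set c' = A" if "P c'" for c'
    using that by (auto simp: P_def min_odd_cyc_def cyc_def)
  have headP: "\<exists>c'. P (x # c')" if x: "x \<in> A" for x
  proof -
    obtain u w where uw: "c = u @ x # w" using x split_list unfolding A_def by metis
    then have "P (x # w @ u)" using rot[of u "x # w"] Pc by simp
    then show ?thesis by blast
  qed
  have grow: "\<not> unbalanced K (V - insert s B)" if "s \<in> V" "s \<notin> B" "adj s b" "b \<in> B" for s b
  proof
    assume "unbalanced K (V - insert s B)"
    then have "insert s B \<in> ?F" using B that conn_insert by auto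
    then have "B = insert s B" using max by blast
    then show False using that by blast
  qed
  \<comment> \<open>A vertex of \<open>W\<close> next to \<open>B\<close> could join
    \<open>B\<close>: the odd cycle would stay in the complement.\<close>
  have noWB: "\<not> adj w b" if "w \<in> W" "b \<in> B" for w b
  proof
    assume "adj w b"
    then have "\<not> unbalanced K (V - insert w B)" using grow[of w b] that by (auto simp: W_def)
    moreover have "A \<subseteq> V - insert w B" using that AB by (auto simp: W_def)
    ultimately show False using oddA unbalanced_mono by blast
  qed
  \<comment> \<open>Without one attachment \<open>s\<close> of \<open>B\<close>, cycle and
    \<open>W\<close> together are balanced, since otherwise \<open>s\<close> could join
    \<open>B\<close>. The later contradictions about parity rest on this.\<close>
  have growN: "\<not> unbalanced K Z" if "s \<in> N" "Z \<subseteq> A \<union> W - {s}" for s Z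
  proof -
    obtain b where "b \<in> B" "adj s b" "s \<in> A" using \<open>s \<in> N\<close> by (auto simp: N_def)
    then have "\<not> unbalanced K (V - insert s B)" using grow[of s b] AB by auto
    moreover have "Z \<subseteq> V - insert s B" using that(2) AB by (auto simp: W_def)
    ultimately show ?thesis using unbalanced_mono by blast
  qed
  have "W = {}"
  proof (rule ccontr)
    assume "W \<noteq> {}"
    then obtain w0 where w0: "w0 \<in> W" by blast
    obtain b0 where b0: "b0 \<in> B" using B(3) by (auto simp: conn_def)
    have w0V: "w0 \<in> V" "w0 \<notin> A" "w0 \<notin> B" using w0 by (auto simp: W_def)
    \<comment> \<open>There are no edges between \<open>W\<close> and \<open>B\<close>, so
      \<open>N\<close> separates \<open>b0\<close> from \<open>w0\<close>.\<close>
    have cardN: "card N \<ge> 3"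
    proof (rule ccontr)
      assume "\<not> card N \<ge> 3"
      then have cn: "conn (V - N)" using conn3[of N] AB by (auto simp: N_def)
      have "\<exists>s t. s \<in> (V - N) \<inter> B \<and> t \<in> (V - N) - B \<and> adj s t"
      proof (rule conn_cross[OF cn])
        show "b0 \<in> V - N" "b0 \<in> B" using b0 B(2) AB by (auto simp: N_def)
        show "w0 \<in> V - N" "w0 \<notin> B" using w0V by (auto simp: N_def)
      qed
      then obtain s t where "s \<in> B" "t \<in> V" "t \<notin> N" "t \<notin> B" "adj s t" by blast
      then show False using noWB[of t s] by (auto simp: N_def W_def insert_commute)
    qed
    define wl where "wl x y \<longleftrightarrow> (\<exists>w w'. w \<in> W \<and> w' \<in> W \<and> adj x w \<and> adj w' y \<and> (w, w') \<in> (adj_in W)\<^sup>*)" for x y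
    have no_split: False if "P (x # a @ y # b)" "N \<inter> set a \<noteq> {}" "N \<inter> set b \<noteq> {}" "wl x y" for x a y b
    proof -
      let ?c = "x # a @ y # b"
      have cy: "cyc ?c" "wpar K (?c @ [hd ?c])" using that(1) by (auto simp: P_def min_odd_cyc_def)
      have d: "distinct ?c" and sc: "set ?c = A" using Pd[OF that(1)] by auto
      obtain w w' where w: "w \<in> W" "w' \<in> W" "adj x w" "adj w' y" "(w, w') \<in> (adj_in W)\<^sup>*"
        using \<open>wl x y\<close> unfolding wl_def by blast
      obtain g where g: "pw K W w w' g" using pw_rtrancl[OF w(5,1)] by blast
      define Z1 where "Z1 = set (x # a @ [y]) \<union> W"
      define Z2 where "Z2 = set (y # b @ [x]) \<union> W"
      have g12: "\<exists>g'. pw K Z1 x y g' \<and> pw K Z2 x y g'"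
      proof -
        have "pw K Z x y ((({x, w} \<in> K) \<noteq> g) \<noteq> ({w', y} \<in> K))"
          if "W \<subseteq> Z" "x \<in> Z" "y \<in> Z" for Z
          using pw_trans[OF pw_trans[OF pw_edge[OF w(3), of Z] pw_mono[OF g that(1)]] pw_edge[OF w(4), of Z]]
            that w by auto
        from this[of Z1] this[of Z2] show ?thesis unfolding Z1_def Z2_def by auto
      qed
      then obtain g' where g': "pw K Z1 x y g'" "pw K Z2 x y g'" by blast
      have p1: "pw K Z1 x y (wpar K (x # a @ [y]))"
        using pw_list[of "x # a @ [y]" Z1] cyc_split(1)[OF cy(1)] by (auto simp: Z1_def)
      have p2: "pw K Z2 y x (wpar K (y # b @ [x]))"
        using pw_list[of "y # b @ [x]" Z2] cyc_split(2)[OF cy(1)] by (auto simp: Z2_def)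
      have "wpar K (x # a @ [y]) \<noteq> wpar K (y # b @ [x])"
        using cy(2) cyc_split(3)[OF cy(1), of K] by blast
      then have un: "unbalanced K Z1 \<or> unbalanced K Z2"
        using unbalancedI[OF p1 g'(1)] unbalancedI[OF pw_sym[OF p2] g'(2)] by blast
      note that' = that(2,3)
      obtain sa sb where s: "sa \<in> N" "sa \<in> set a" "sb \<in> N" "sb \<in> set b" using that' by blast
      have "Z1 \<subseteq> A \<union> W - {sb}" "Z2 \<subseteq> A \<union> W - {sa}"
        using s d sc AB by (auto simp: Z1_def Z2_def W_def)
      then show False using growN s un by blast
    qed
    show False
    proof (cases "A \<subseteq> N")
      case False
      \<comment> \<open>Starting at the non-attachment \<open>y\<close>, \<open>b1\<close> and
        \<open>b3\<close> are the first attachments met in the two directions and \<open>b2\<close>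
        is one between them. The arc \<open>Q\<close> around \<open>y\<close> contains no
        attachment.\<close>
      then obtain y where y: "y \<in> A" "y \<notin> N" by blast
      obtain c' where c': "P (y # c')" using headP[OF y(1)] by blast
      have Nc: "N \<subseteq> set c'" using Pd(2)[OF c'] y by (auto simp: N_def)
      have "N \<noteq> {}" using cardN by auto
      then obtain r1 b1 r2 where r1: "c' = r1 @ b1 # r2" "b1 \<in> N" "\<forall>x\<in>set r1. x \<notin> N"
        using split_list_first_prop[of c' "\<lambda>x. x \<in> N"] Nc by blast
      have "\<not> N \<subseteq> {b1}" using cardN card_mono[of "{b1}" N] by auto
      then have "\<exists>x\<in>set r2. x \<in> N" using Nc r1 by auto
      then obtain r3 b3 r4 where r3: "r2 = r3 @ b3 # r4" "b3 \<in> N" "\<forall>x\<in>set r4. x \<notin> N"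
        using split_list_last_prop[of r2 "\<lambda>x. x \<in> N"] by blast
      have "\<not> N \<subseteq> {b1, b3}" using cardN card_mono[of "{b1, b3}" N] by (auto simp: card_insert_if split: if_splits)
      then obtain b2 where b2: "b2 \<in> set r3" "b2 \<in> N" using Nc r1 r3 by auto
      have Pfull: "P (y # r1 @ b1 # r3 @ b3 # r4)" using c' r1 r3 by simp
      note dA = Pd[OF Pfull]
      define Q where "Q = {y} \<union> set r1 \<union> set r4"
      have NQ: "N \<inter> Q = {}" using r1 r3 y by (auto simp: Q_def)
      have sep: "\<exists>a b. P (x # a @ t # b) \<and> b3 \<in> set a \<and> b1 \<in> set b"
        if xt: "x \<in> set r3" "t \<in> Q" for x t
      proof -
        obtain p q where pq: "r3 = p @ x # q" using xt split_list by metis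
        have base: "P (x # q @ b3 # r4 @ y # r1 @ b1 # p)"
          using rot[of "y # r1 @ b1 # p" "x # q @ b3 # r4"] Pfull pq by simp
        consider "t = y" | "t \<in> set r1" | "t \<in> set r4" using xt by (auto simp: Q_def)
        then show ?thesis
        proof cases
          case 1
          then show ?thesis using base
            by (intro exI[of _ "q @ b3 # r4"] exI[of _ "r1 @ b1 # p"]) simp
        next
          case 2
          then obtain s s' where "r1 = s @ t # s'" using split_list by metis
          then show ?thesis using base
            by (intro exI[of _ "q @ b3 # r4 @ y # s"] exI[of _ "s' @ b1 # p"]) simp
        next
          case 3
          then obtain s s' where "r4 = s @ t # s'" using split_list by metis
          then show ?thesis using base
            by (intro exI[of _ "q @ b3 # s"] exI[of _ "s' @ y # r1 @ b1 # p"]) simp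
        qed
      qed
      define R where "R = {w' \<in> W. \<exists>x\<in>set r3. \<exists>w\<in>W. adj x w \<and> (w, w') \<in> (adj_in W)\<^sup>*}"
      \<comment> \<open>\<open>I\<close> is the part that \<open>b1\<close> and \<open>b3\<close>
        would have to cut off from \<open>y\<close>. An edge leaving it would be a chord, or give
        \<open>Q\<close> an attachment of \<open>B\<close>, or complete a walk through
        \<open>W\<close> from \<open>set r3\<close> to \<open>Q\<close>, or stay within
        \<open>W\<close> and so end in \<open>R\<close> after all.\<close>
      define I where "I = set r3 \<union> B \<union> R"
      have AQ: "A = set r3 \<union> {b1, b3} \<union> Q" using dA(2) by (auto simp: Q_def)
      have dis: "set r3 \<inter> Q = {}" "b1 \<notin> Q" "b3 \<notin> Q" "b1 \<notin> set r3" "b3 \<notin> set r3" "b1 \<noteq> b3"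
        using dA(1) by (auto simp: Q_def)
      have cn: "conn (V - {b1, b3})"
        using conn3[of "{b1, b3}"] dis AB AQ by auto
      have yI: "y \<notin> I" using y AB dis by (auto simp: I_def R_def Q_def W_def)
      have "\<exists>s t. s \<in> (V - {b1, b3}) \<inter> I \<and> t \<in> (V - {b1, b3}) - I \<and> adj s t"
      proof (rule conn_cross[OF cn])
        show "b2 \<in> V - {b1, b3}" "b2 \<in> I" using b2 AB AQ dis by (auto simp: I_def)
        show "y \<in> V - {b1, b3}" using y AB dis by (auto simp: Q_def)
        show "y \<notin> I" by (rule yI)
      qed
      then obtain s t where st: "s \<in> I" "t \<in> V" "t \<notin> {b1, b3}" "t \<notin> I" "adj s t" by blast
      have t: "t \<in> Q \<or> t \<in> W" using st AQ by (auto simp: I_def W_def)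
      consider "s \<in> set r3" | "s \<in> B" | "s \<in> R" using st by (auto simp: I_def)
      then show False
      proof cases
        case 1
        show False
        proof (cases "t \<in> W")
          case True
          then have "t \<in> R" using 1 st by (auto simp: R_def)
          then show False using st by (simp add: I_def)
        next
          case False
          then obtain a b where "P (s # a @ t # b)" "b3 \<in> set a" "b1 \<in> set b" using sep 1 t by blast
          moreover from this have "a \<noteq> []" "b \<noteq> []" by auto
          ultimately show False using min_odd_cyc_chordless[of K s a t b] st by (simp add: P_def)
        qed
      next
        case 2
        have "t \<notin> W" using noWB[of t s] 2 st(5) adj_sym by blast
        then have "t \<in> Q" using t by blast
        then have "t \<in> N" using 2 adj_sym[OF st(5)] AQ unfolding N_def by blast
        then show False using \<open>t \<in> Q\<close> NQ by blast
      next
        case 3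
        then obtain x w where x: "x \<in> set r3" "w \<in> W" "adj x w" "(w, s) \<in> (adj_in W)\<^sup>*" "s \<in> W"
          by (auto simp: R_def)
        show False
        proof (cases "t \<in> W")
          case True
          then have "(w, t) \<in> (adj_in W)\<^sup>*" using x st by (auto simp: adj_in_def intro: rtrancl_into_rtrancl)
          then have "t \<in> R" using True x by (auto simp: R_def)
          then show False using st by (simp add: I_def)
        next
          case False
          then obtain a b where ab: "P (x # a @ t # b)" "b3 \<in> set a" "b1 \<in> set b" using sep x t by blast
          have "wl x t" unfolding wl_def using x st by blast
          then show False using no_split ab r1 r3 by blast
        qed
      qed
    next
      case True
      \<comment> \<open>Now every cycle vertex is an attachment of \<open>B\<close>, so
        \<open>no_split\<close> forces any two attachments of the component \<open>B'\<close> to be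
        consecutive on the cycle. Three of them make the cycle a triangle.\<close>
      define B' where "B' = {w. (w0, w) \<in> (adj_in W)\<^sup>*}"
      have B'W: "B' \<subseteq> W" using w0 adj_in_stays by (auto simp: B'_def)
      define T where "T = {s \<in> A. \<exists>b\<in>B'. adj s b}"
      have cardT: "card T \<ge> 3"
      proof (rule ccontr)
        assume "\<not> card T \<ge> 3"
        then have cn: "conn (V - T)" using conn3[of T] AB by (auto simp: T_def)
        have "\<exists>s t. s \<in> (V - T) \<inter> B' \<and> t \<in> (V - T) - B' \<and> adj s t"
        proof (rule conn_cross[OF cn])
          show "w0 \<in> V - T" "w0 \<in> B'" using w0V by (auto simp: T_def B'_def)
          show "b0 \<in> V - T" "b0 \<notin> B'" using b0 B(2) AB B'W by (auto simp: T_def W_def)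
        qed
        then obtain s t where st: "s \<in> B'" "t \<in> V" "t \<notin> T" "t \<notin> B'" "adj s t" by blast
        have "t \<notin> W"
          using st B'W unfolding B'_def adj_in_def
          by (auto simp: adj_in_def intro: rtrancl_into_rtrancl)
        then show False using st noWB[of s t] B'W by (auto simp: T_def W_def insert_commute)
      qed
      have B'conn: "(u, v) \<in> (adj_in W)\<^sup>*" if "u \<in> B'" "v \<in> B'" for u v
        using that adj_in_rtrancl_sym rtrancl_trans unfolding B'_def by (metis mem_Collect_eq)
      have wlT: "wl x y" if "x \<in> T" "y \<in> T" for x y
      proof -
        obtain w w' where "w \<in> B'" "w' \<in> B'" "adj x w" "adj w' y"
          using \<open>x \<in> T\<close> \<open>y \<in> T\<close> adj_sym unfolding T_def by blast
        then show ?thesis using B'conn[of w w'] B'W unfolding wl_def by blast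
      qed
      have noT: "a = [] \<or> b = []" if "P (x # a @ y # b)" "x \<in> T" "y \<in> T" for x a y b
      proof (rule ccontr)
        assume "\<not> ?thesis"
        moreover have "set a \<subseteq> N" "set b \<subseteq> N" using Pd(2)[OF that(1)] True by auto
        ultimately have "N \<inter> set a \<noteq> {}" "N \<inter> set b \<noteq> {}" by (auto simp: Int_absorb1)
        then show False using no_split[OF that(1) _ _ wlT[OF that(2,3)]] by blast
      qed
      obtain T' where T': "T' \<subseteq> T" "card T' = 3" "finite T'"
        by (rule obtain_subset_with_card_n[OF cardT])
      then obtain p q r where pqr: "T' = {p, q, r}" "p \<noteq> q" "q \<noteq> r" "p \<noteq> r" using card_3_iff by metis
      have pT: "p \<in> T" "q \<in> T" "r \<in> T" using T' pqr by auto
      then have pA: "p \<in> A" "q \<in> A" "r \<in> A" by (auto simp: T_def)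
      obtain c' where c': "P (p # c')" using headP pA by blast
      have "q \<in> set c'" "r \<in> set c'" using Pd(2)[OF c'] pA pqr by auto
      then obtain h m z where hmz: "c' = h # m @ [z]"
        using pqr(3) by (cases c'; cases "tl c'" rule: rev_cases) auto
      have notm: "t \<notin> set m" if "t \<in> T" for t
      proof
        assume "t \<in> set m"
        then obtain m1 m2 where "m = m1 @ t # m2" using split_list by metis
        then have "P (p # (h # m1) @ t # m2 @ [z])" using c' hmz by simp
        from noT[OF this pT(1) that] show False by simp
      qed
      have hz: "{q, r} = {h, z}" using notm pT \<open>q \<in> set c'\<close> \<open>r \<in> set c'\<close> hmz pqr by auto
      then have hzT: "h \<in> T" "z \<in> T" using pT by (auto simp: doubleton_eq_iff)
      have "P (h # m @ z # [p])" using rot[of "[p]" "h # m @ [z]"] c' hmz by simp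
      from noT[OF this hzT] have m: "m = []" by simp
      then have P3: "P [p, h, z]" using c' hmz by simp
      have tri: "adj p h" "adj h z" "adj z p" "({p, h} \<in> K) \<noteq> (({h, z} \<in> K) \<noteq> ({z, p} \<in> K))"
        using P3 by (auto simp: P_def min_odd_cyc_def cyc_def)
      have phz: "distinct [p, h, z]" "A = {p, h, z}" using Pd[OF P3] by auto
      have toroot: "\<exists>b. pw K (insert x W) x w0 b" if "x \<in> T" for x
      proof -
        obtain w where w: "w \<in> B'" "adj x w" using \<open>x \<in> T\<close> by (auto simp: T_def)
        obtain b where b: "pw K W w w0 b"
          using pw_rtrancl[OF B'conn[of w w0]] w B'W by (auto simp: B'_def)
        show ?thesis
          using pw_trans[OF pw_edge[OF w(2), of "insert x W"] pw_mono[OF b, of "insert x W"]] w B'W by blast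
      qed
      \<comment> \<open>On a triangle one of the arcs is empty and \<open>no_split\<close> says
        nothing. Instead each corner gets the parity of a walk through \<open>W\<close> to
        \<open>w0\<close>. Two corners and \<open>W\<close> miss the third corner, an attachment, so
        an edge carries the difference of its corners; three such differences around the triangle
        cancel.\<close>
      have even3: "({x, y} \<in> K) = (bx \<noteq> by)"
        if "adj x y" "pw K (insert x W) x w0 bx" "pw K (insert y W) y w0 by" "s \<in> A"
           "x \<in> A" "y \<in> A" "s \<noteq> x" "s \<noteq> y" for x y s bx "by"
      proof -
        define Z where "Z = {x, y} \<union> W"
        have "Z \<subseteq> A \<union> W - {s}" using that by (auto simp: Z_def W_def)
        then have nz: "\<not> unbalanced K Z" using growN[of s Z] that(4) True by blast
        have "pw K Z x y (bx \<noteq> by)"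
          using pw_trans[OF pw_mono[OF that(2), of Z] pw_sym[OF pw_mono[OF that(3), of Z]]]
          by (auto simp: Z_def)
        moreover have "pw K Z x y ({x, y} \<in> K)" using pw_edge[OF that(1)] by (simp add: Z_def)
        ultimately show ?thesis using unbalancedI nz by blast
      qed
      obtain bp bh bz where "pw K (insert p W) p w0 bp" "pw K (insert h W) h w0 bh" "pw K (insert z W) z w0 bz"
        using toroot[OF pT(1)] toroot[OF hzT(1)] toroot[OF hzT(2)] by metis
      then have "({p, h} \<in> K) = (bp \<noteq> bh)" "({h, z} \<in> K) = (bh \<noteq> bz)" "({z, p} \<in> K) = (bz \<noteq> bp)"
        using even3[of p h bp bh z] even3[of h z bh bz p] even3[of z p bz bp h] tri phz by auto
      then show False using tri(4) by blast
    qed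
  qed
  then have "V - set c = B" using B(2) AB by (auto simp: W_def A_def)
  then have "face (set c)"
    using c(1) min_odd_cyc_induced B(3) unfolding face_def min_odd_cyc_def by auto
  then show ?thesis using that[of c] c B(1) unfolding min_odd_cyc_def by blast
qed

text \<open>A vertex off some odd cycle is all that \<open>odd_face_avoiding\<close> needs to start.
  A minimal odd cycle through all vertices is impossible, as it is induced and would leave every
  degree equal to two.\<close>

lemma odd_face:
  assumes "unbalanced K V"
  obtains c where "cyc c" "wpar K (c @ [hd c])" "face (set c)"
proof -
  obtain c where c: "min_odd_cyc K c" "set c \<subseteq> V" using unbalanced_min_odd_cyc assms finV by blast
  obtain v where v: "v \<in> set c" using c by (cases c) (auto simp: min_odd_cyc_def cyc_def)
  have "set c \<noteq> V"
  proof
    assume "set c = V"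
    then have "card (nbrs v) = 2"
      using min_odd_cyc_induced[OF c(1) v] nbrs_subset(1)[of v] by (simp add: Int_absorb2)
    then show False using card_nbrs_ge_3[of v] v \<open>set c = V\<close> by simp
  qed
  then obtain s where s: "s \<in> V" "s \<notin> set c" using c by blast
  have "unbalanced K (set c)" using c cyc_unbalanced by (auto simp: min_odd_cyc_def)
  then have "unbalanced K (V - {s})" using unbalanced_mono s c by (metis subset_Diff_insert Diff_empty)
  then show ?thesis using odd_face_avoiding[of "{s}" K] s conn_singleton that by (metis empty_subsetI insert_subset)
qed

end

section \<open>Faces of plane graphs\<close>

lemma connected_arc_minus_finish:
  fixes g :: "real \<Rightarrow> 'b::real_normed_vector"
  assumes "arc g"
  shows "connected (path_image g - {pathfinish g})"
proof -
  have "path_image g - {pathfinish g} = g ` {0..<1}"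
  proof -
    have "{0..1} = insert 1 {0..<1::real}" by auto
    then have "path_image g = insert (g 1) (g ` {0..<1})" by (simp add: path_image_def)
    moreover have "g 1 \<notin> g ` {0..<1}"
      using assms unfolding arc_def by (auto dest: inj_onD)
    ultimately show ?thesis by (auto simp: pathfinish_def)
  qed
  moreover have "connected (g ` {0..<1})"
    using assms by (intro connected_continuous_image)
      (auto simp: arc_def path_def elim: continuous_on_subset)
  ultimately show ?thesis by simp
qed

context sgraph begin

lemma ledges_subset_E: "successively adj xs \<Longrightarrow> ledges xs \<subseteq> E"
  by (induction xs rule: ledges.induct) auto

lemma cyc_edges:
  assumes "cyc c" "\<And>v. v \<in> set c \<Longrightarrow> card (nbrs v \<inter> set c) = 2"
  shows "ledges (c @ [hd c]) = {e \<in> E. e \<subseteq> set c}"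
proof (intro equalityI subsetI)
  fix e assume e: "e \<in> ledges (c @ [hd c])"
  have "e \<in> E" using e ledges_subset_E[of "c @ [hd c]"] assms(1) by (auto simp: cyc_def)
  moreover have "e \<subseteq> set c"
    using ledges_subset[OF e] assms(1) by (cases c) (auto simp: cyc_def)
  ultimately show "e \<in> {e \<in> E. e \<subseteq> set c}" by simp
next
  fix e assume e: "e \<in> {e \<in> E. e \<subseteq> set c}"
  then obtain u w where uw: "e = {u, w}" "adj u w" "u \<in> set c" "w \<in> set c"
    by (auto elim: edgeE)
  obtain a b y m z where ab: "c = a @ b" "b @ a = u # y # m @ [z]"
    and nb: "nbrs u \<inter> set c = {y, z}"
    using induced_cyc_at[OF assms(1) uw(3) assms(2)[OF uw(3)]] by metis
  have "w \<in> nbrs u \<inter> set c" using uw by (simp add: nbrs_def)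
  then have w: "w = y \<or> w = z" using nb by blast
  have "ledges (c @ [hd c]) = ledges ((u # y # m @ [z]) @ [u])"
    using ledges_rotate[of a b] ab by simp
  also have "\<dots> = {{u, y}, {z, u}} \<union> ledges (y # m @ [z])"
    using ledges_append[of "u # y # m" z "[u]"] by auto
  finally show "e \<in> ledges (c @ [hd c])" using w uw by auto
qed

text \<open>With the chosen edge as the closing one, the list itself is the rest of the cycle as a
  path.\<close>

lemma cyc_close:
  assumes "cyc c" "\<And>v. v \<in> set c \<Longrightarrow> card (nbrs v \<inter> set c) = 2" "e \<in> E" "e \<subseteq> set c"
  obtains d where "cyc d" "set d = set c" "e = {hd d, last d}"
proof -
  obtain u w where uw: "e = {u, w}" "adj u w" "u \<in> set c" "w \<in> set c"
    using assms by (auto elim: edgeE)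
  obtain a b y m z where cy: "cyc (u # y # m @ [z])" and sc: "set c = {u, y, z} \<union> set m"
    and nb: "nbrs u \<inter> set c = {y, z}"
    using induced_cyc_at[OF assms(1) uw(3) assms(2)[OF uw(3)]] by metis
  have "w \<in> nbrs u \<inter> set c" using uw by (simp add: nbrs_def)
  then have "w = y \<or> w = z" using nb by blast
  then show ?thesis
  proof
    assume "w = z"
    then show ?thesis using that[OF cy] uw sc by auto
  next
    assume "w = y"
    moreover have "cyc (y # m @ [z] @ [u])" using cyc_rotate[of "[u]" "y # m @ [z]"] cy by simp
    ultimately show ?thesis using that[of "y # m @ [z] @ [u]"] uw sc by auto
  qed
qed

end

section \<open>Faces as Jordan curves in a plane drawing\<close>

locale plane_graph = three_connected +
  fixes p :: "'a \<Rightarrow> complex" and \<gamma> :: "'a set \<Rightarrow> real \<Rightarrow> complex"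
  assumes drawing: "plane_drawing \<lparr>gverts = V, gedges = E\<rparr> p \<gamma>"
begin

lemma inj_p: "inj_on p V"
  and arc_\<gamma>: "e \<in> E \<Longrightarrow> arc (\<gamma> e)"
  and ends_\<gamma>: "e \<in> E \<Longrightarrow> {pathstart (\<gamma> e), pathfinish (\<gamma> e)} = p ` e"
  and verts_\<gamma>: "e \<in> E \<Longrightarrow> path_image (\<gamma> e) \<inter> p ` V = p ` e"
  and meet_\<gamma>: "e \<in> E \<Longrightarrow> f \<in> E \<Longrightarrow> e \<noteq> f \<Longrightarrow>
    path_image (\<gamma> e) \<inter> path_image (\<gamma> f) = p ` (e \<inter> f)"
  using drawing by (simp_all add: plane_drawing_def)

text \<open>A drawing leaves the direction of each arc open; reversing the arc fixes it.\<close>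

lemma edge_arc:
  assumes "adj u v"
  obtains g where "arc g" "pathstart g = p u" "pathfinish g = p v"
    "path_image g = path_image (\<gamma> {u, v})"
proof -
  have a: "arc (\<gamma> {u, v})" "{pathstart (\<gamma> {u, v}), pathfinish (\<gamma> {u, v})} = {p u, p v}"
    using arc_\<gamma>[OF assms] ends_\<gamma>[OF assms] by auto
  then consider "pathstart (\<gamma> {u, v}) = p u" "pathfinish (\<gamma> {u, v}) = p v"
    | "pathstart (\<gamma> {u, v}) = p v" "pathfinish (\<gamma> {u, v}) = p u"
    by (auto simp: doubleton_eq_iff)
  then show ?thesis
  proof cases
    case 1 then show ?thesis using that[of "\<gamma> {u, v}"] a by simp
  next
    case 2 then show ?thesis using that[of "reversepath (\<gamma> {u, v})"] a
      by (simp add: arc_reversepath)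
  qed
qed

lemma list_arc:
  assumes "distinct xs" "successively adj xs" "length xs \<ge> 2"
  shows "\<exists>g. arc g \<and> pathstart g = p (hd xs) \<and> pathfinish g = p (last xs) \<and>
    path_image g = (\<Union>e\<in>ledges xs. path_image (\<gamma> e))"
  using assms
proof (induction xs rule: ledges.induct)
  case (1 x y zs)
  have xy: "adj x y" using 1 by simp
  obtain g1 where g1: "arc g1" "pathstart g1 = p x" "pathfinish g1 = p y"
    "path_image g1 = path_image (\<gamma> {x, y})"
    using edge_arc[OF xy] by metis
  show ?case
  proof (cases "zs = []")
    case True
    then show ?thesis using g1 by auto
  next
    case False
    then obtain g2 where g2: "arc g2" "pathstart g2 = p y" "pathfinish g2 = p (last zs)"
      "path_image g2 = (\<Union>e\<in>ledges (y # zs). path_image (\<gamma> e))"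
      using 1 by (cases zs) auto
    have "path_image g1 \<inter> path_image g2 \<subseteq> {pathstart g2}"
    proof -
      have "path_image (\<gamma> {x, y}) \<inter> path_image (\<gamma> f) \<subseteq> {p y}" if f: "f \<in> ledges (y # zs)" for f
      proof -
        have "x \<notin> f" using ledges_subset[OF f] 1(2) by auto
        moreover have "f \<in> E" using f ledges_subset_E[of "y # zs"] 1(3) by auto
        ultimately show ?thesis using meet_\<gamma>[OF xy, of f] by auto
      qed
      then show ?thesis using g1 g2 by auto
    qed
    then have "arc (g1 +++ g2)" using arc_join g1 g2 by metis
    moreover have "path_image (g1 +++ g2) = (\<Union>e\<in>ledges (x # y # zs). path_image (\<gamma> e))"
      using path_image_join[of g1 g2] g1 g2 by auto
    ultimately show ?thesis using g1 g2 False
      by (intro exI[of _ "g1 +++ g2"]) auto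
  qed
qed auto

text \<open>For a face this is the drawn cycle, because a face has no chords.\<close>

definition curve :: "'a set \<Rightarrow> complex set" where
  "curve S = (\<Union>e\<in>{e \<in> E. e \<subseteq> S}. path_image (\<gamma> e))"

text \<open>Both descriptions of the same set are needed: the closed curve for the Jordan curve
  theorem, and the arc left after removing one edge for Janiszewski's theorem.\<close>

lemma face_decomp:
  assumes "face S" "e \<in> E" "e \<subseteq> S"
  obtains g c where "arc g" "curve S = path_image g \<union> path_image (\<gamma> e)"
    "path_image g \<inter> path_image (\<gamma> e) = p ` e"
    "simple_path c" "pathfinish c = pathstart c" "path_image c = curve S"
proof -
  obtain c0 where c0: "cyc c0" "set c0 = S" "\<And>v. v \<in> set c0 \<Longrightarrow> card (nbrs v \<inter> set c0) = 2"
    using assms unfolding face_def by blast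
  obtain d where d: "cyc d" "set d = S" "e = {hd d, last d}"
    using cyc_close[OF c0(1,3) assms(2)] assms(3) c0(2) by metis
  have dd: "distinct d" "length d \<ge> 3" "successively adj d"
    using d(1) by (auto simp: cyc_def successively_append_iff)
  obtain g where g: "arc g" "pathstart g = p (hd d)" "pathfinish g = p (last d)"
    "path_image g = (\<Union>f\<in>ledges d. path_image (\<gamma> f))"
    using list_arc[of d] dd by auto
  obtain x y m z where xyz: "d = x # y # m @ [z]"
  proof -
    obtain x y r where "d = x # y # r" "r \<noteq> []"
      using dd(2) by (cases d; cases "tl d"; cases "tl (tl d)") auto
    then show ?thesis using that[of x y "butlast r" "last r"] by simp
  qed
  have "ledges (d @ [hd d]) = ledges d \<union> {e}"
    using ledges_append[of "x # y # m" z "[x]"] d(3) xyz by (auto simp: insert_commute)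
  moreover have "ledges (d @ [hd d]) = {e \<in> E. e \<subseteq> S}"
    using cyc_edges[OF d(1)] assms(1) d(2) unfolding face_def by metis
  ultimately have ed: "{e \<in> E. e \<subseteq> S} = ledges d \<union> {e}" by simp
  have e_notin: "e \<notin> ledges d"
  proof -
    have "{z, x} \<notin> ledges (y # m @ [z])" using ledges_subset dd(1) xyz by fastforce
    moreover have "{z, x} \<noteq> {x, y}" using dd(1) xyz by (auto simp: doubleton_eq_iff)
    ultimately show ?thesis using d(3) xyz by (simp add: insert_commute)
  qed
  have cv: "curve S = path_image g \<union> path_image (\<gamma> e)"
    unfolding curve_def ed g(4) by auto
  have sub: "path_image g \<inter> path_image (\<gamma> e) \<subseteq> p ` e"
  proof -
    have "path_image (\<gamma> f) \<inter> path_image (\<gamma> e) \<subseteq> p ` e" if "f \<in> ledges d" for f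
    proof -
      have "f \<in> E" "f \<noteq> e" using that ed e_notin by auto
      then show ?thesis using meet_\<gamma>[of f e] assms(2) by auto
    qed
    then show ?thesis using g(4) by auto
  qed
  moreover have "p ` e \<subseteq> path_image g"
    using g d(3) pathstart_in_path_image[of g] pathfinish_in_path_image[of g] by auto
  moreover have "p ` e \<subseteq> path_image (\<gamma> e)" using verts_\<gamma>[OF assms(2)] by blast
  ultimately have meet: "path_image g \<inter> path_image (\<gamma> e) = p ` e" by blast
  have ad: "adj (last d) (hd d)" using d(3) assms(2) by (simp add: insert_commute)
  obtain h where h: "arc h" "pathstart h = p (last d)" "pathfinish h = p (hd d)"
    "path_image h = path_image (\<gamma> e)"
    using edge_arc[OF ad] d(3) by (metis insert_commute)
  have "simple_path (g +++ h)"
    using g h meet d(3) by (intro simple_path_join_loop) auto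
  moreover have "path_image (g +++ h) = curve S" using cv g h by (simp add: path_image_join)
  ultimately show ?thesis using that[of g "g +++ h"] g h cv meet by simp
qed

lemma face_edge: "face S \<Longrightarrow> \<exists>e\<in>E. e \<subseteq> S"
proof -
  assume "face S"
  then obtain c where c: "cyc c" "set c = S" unfolding face_def by blast
  obtain x y r where "c = x # y # r"
    using c by (cases c; cases "tl c") (auto simp: cyc_def)
  then have "{x, y} \<in> E" "{x, y} \<subseteq> S" using c by (auto simp: cyc_def)
  then show ?thesis by blast
qed

lemma curve_verts:
  assumes "face S"
  shows "curve S \<inter> p ` V = p ` S"
proof
  show "curve S \<inter> p ` V \<subseteq> p ` S" unfolding curve_def using verts_\<gamma> by fast
  show "p ` S \<subseteq> curve S \<inter> p ` V"
  proof
    fix q assume "q \<in> p ` S"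
    then obtain v where v: "v \<in> S" "q = p v" by blast
    have "card (nbrs v \<inter> S) = 2" using assms v by (simp add: face_def)
    then have "nbrs v \<inter> S \<noteq> {}" by auto
    then obtain w where "w \<in> nbrs v \<inter> S" by blast
    then have "{v, w} \<in> E" "{v, w} \<subseteq> S" using v by (auto simp: nbrs_def)
    then show "q \<in> curve S \<inter> p ` V"
      using verts_\<gamma>[of "{v, w}"] v face_facts(1)[OF assms] unfolding curve_def by blast
  qed
qed

lemma edge_off_curve:
  assumes "e \<in> E"
  shows "path_image (\<gamma> e) \<inter> curve S \<subseteq> p ` (e \<inter> S) \<or> e \<subseteq> S"
  using meet_\<gamma>[OF assms] unfolding curve_def by fastforce

text \<open>Since G - S is connected and S has no chords, the whole drawing lies on one side of the
  Jordan curve of S; R is the other side.\<close>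

lemma face_region:
  assumes "face S"
  obtains R where "connected R" "frontier R = curve S" "\<And>e. e \<in> E \<Longrightarrow> R \<inter> path_image (\<gamma> e) = {}"
    "\<And>a b. a \<in> R \<Longrightarrow> b \<notin> R \<Longrightarrow> \<not> connected_component (- curve S) a b"
    "\<And>a b. a \<notin> R \<Longrightarrow> b \<notin> R \<Longrightarrow> a \<notin> curve S \<Longrightarrow> b \<notin> curve S \<Longrightarrow> connected_component (- curve S) a b"
proof -
  note goal = that
  let ?J = "curve S"
  obtain e0 where "e0 \<in> E" "e0 \<subseteq> S" using face_edge assms by blast
  then obtain c where c: "simple_path c" "pathfinish c = pathstart c" "path_image c = ?J"
    using face_decomp[OF assms] by metis
  have jo: "inside ?J \<noteq> {}" "connected (inside ?J)" "connected (outside ?J)"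
    "inside ?J \<inter> outside ?J = {}" "inside ?J \<union> outside ?J = - ?J"
    "frontier (inside ?J) = ?J" "frontier (outside ?J) = ?J"
    using Jordan_inside_outside[OF c(1,2)] c(3) by auto
  have cn: "conn (V - S)" using assms by (simp add: face_def)
  then obtain w0 where w0: "w0 \<in> V - S" by (auto simp: conn_def)
  define D where "D = connected_component_set (- ?J) (p w0)"
  have offJ: "p w \<notin> ?J" if "w \<in> V - S" for w
  proof
    assume "p w \<in> ?J"
    then have "p w \<in> p ` S" using curve_verts[OF assms] that by blast
    then show False using inj_p that face_facts(1)[OF assms] by (auto dest: inj_onD)
  qed
  have side: "path_image (\<gamma> e) - ?J \<subseteq> connected_component_set (- ?J) (p w)"
    if "e \<in> E" "w \<in> e" "w \<in> V - S" for e w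
  proof -
    obtain s where s: "e = {w, s}" "adj w s" using \<open>e \<in> E\<close> \<open>w \<in> e\<close>
      by (metis edgeE insert_commute insertE singletonD)
    obtain g where g: "arc g" "pathstart g = p w" "pathfinish g = p s"
      "path_image g = path_image (\<gamma> e)"
      using edge_arc[OF s(2)] s(1) by metis
    have pw: "p w \<in> path_image g" using g(2) pathstart_in_path_image by metis
    have off: "path_image (\<gamma> e) \<inter> ?J \<subseteq> p ` (e \<inter> S)"
      using edge_off_curve[OF that(1), of S] that by blast
    \<comment> \<open>The arc meets the curve at most in its far end \<open>p s\<close>, and an arc
      without an end point is still connected.\<close>
    have "connected (path_image g - ?J)"
    proof (cases "p s \<in> ?J")
      case True
      then have "path_image g - ?J = path_image g - {pathfinish g}" using g off s that by auto
      then show ?thesis using connected_arc_minus_finish[OF g(1)] by simp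
    next
      case False
      have "path_image g - ?J = path_image g"
      proof -
        have "path_image g \<inter> ?J = {}"
        proof (rule ccontr)
          assume "path_image g \<inter> ?J \<noteq> {}"
          then obtain x where x: "x \<in> path_image g" "x \<in> ?J" by blast
          then have "x \<in> p ` (e \<inter> S)" using off g by blast
          then have "x = p s" using s that by auto
          then show False using False x by simp
        qed
        then show ?thesis by blast
      qed
      then show ?thesis using connected_arc_image g(1) by metis
    qed
    moreover have "p w \<in> path_image g - ?J" using pw offJ that by blast
    ultimately show ?thesis using connected_component_maximal[of "p w" "path_image g - ?J" "- ?J"] g
      by auto
  qed
  have inD: "p w \<in> D" if "w \<in> V - S" for w
  proof -
    have "(w0, w) \<in> (adj_in (V - S))\<^sup>*" using cn w0 that by (simp add: conn_def)
    then show ?thesis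
    proof (induction rule: rtrancl_induct)
      case base
      then show ?case using offJ[OF w0] by (simp add: D_def)
    next
      case (step y z)
      then have yz: "adj y z" "y \<in> V - S" "z \<in> V - S" by (auto simp: adj_in_def)
      have "p z \<in> path_image (\<gamma> {y, z})" using verts_\<gamma>[OF yz(1)] by blast
      then have "connected_component (- ?J) (p y) (p z)"
        using side[OF yz(1) _ yz(2)] offJ[OF yz(3)] by auto
      then show ?case using step(3) unfolding D_def
        by (auto intro: connected_component_trans)
    qed
  qed
  have edges: "path_image (\<gamma> e) \<subseteq> D \<union> ?J" if "e \<in> E" for e
  proof (cases "e \<subseteq> S")
    case True
    then show ?thesis using that by (auto simp: curve_def)
  next
    case False
    then obtain w where w: "w \<in> e" "w \<in> V - S" using edge[OF \<open>e \<in> E\<close>] by blast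
    have "connected_component_set (- ?J) (p w) = D"
      using inD[OF w(2)] unfolding D_def by (simp add: connected_component_eq)
    then show ?thesis using side[OF that w] by blast
  qed
  \<comment> \<open>Inside and outside are interchangeable: \<open>R'\<close> is the side with the
    graph on it, \<open>R\<close> the other one, bounded or not.\<close>
  have main: ?thesis if R: "R = inside ?J \<and> R' = outside ?J \<or> R = outside ?J \<and> R' = inside ?J"
    "p w0 \<in> R'" for R R'
  proof -
    have RR: "connected R" "connected R'" "R \<inter> R' = {}" "R \<union> R' = - ?J" "frontier R = ?J"
      using R(1) jo trans[OF Int_commute jo(4)] trans[OF Un_commute jo(5)] by metis+
    have same: "b \<in> X" if "connected_component (- ?J) a b" "a \<in> X" "X = R \<or> X = R'" for X a b
      using that R inside_same_component outside_same_component by metis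
    have "D \<subseteq> R'" using same[of "p w0" _ R'] R(2) by (auto simp: D_def)
    then show ?thesis
    proof (intro goal[of R])
      show "connected R" "frontier R = ?J" using RR by auto
      show "R \<inter> path_image (\<gamma> e) = {}" if "e \<in> E" for e
        using edges[OF that] \<open>D \<subseteq> R'\<close> RR by blast
      show "\<not> connected_component (- ?J) a b" if "a \<in> R" "b \<notin> R" for a b
        using same that by blast
      show "connected_component (- ?J) a b" if "a \<notin> R" "b \<notin> R" "a \<notin> ?J" "b \<notin> ?J" for a b
      proof -
        have "a \<in> R'" "b \<in> R'" using that RR by auto
        then show ?thesis using RR(2,4) unfolding connected_component_def by blast
      qed
    qed
  qed
  have "p w0 \<in> inside ?J \<or> p w0 \<in> outside ?J" using offJ[OF w0] jo by blast
  then show ?thesis using main by blast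
qed

text \<open>By Janiszewski's theorem, whether two points close to an interior point of the edge are separated
  by the curve of a face does not depend on the face. Points a, b in the regions of the first two
  faces are separated by the first curve but not by the third.\<close>

lemma no_three_faces_at_edge:
  assumes e: "e \<in> E"
    and f: "face S1" "face S2" "face S3" "e \<subseteq> S1" "e \<subseteq> S2" "e \<subseteq> S3"
    and ne: "S1 \<noteq> S2" "S1 \<noteq> S3" "S2 \<noteq> S3"
  shows False
proof -
  define reg where "reg S R \<longleftrightarrow> connected R \<and> frontier R = curve S \<and>
    (\<forall>e\<in>E. R \<inter> path_image (\<gamma> e) = {}) \<and>
    (\<forall>a b. a \<in> R \<longrightarrow> b \<notin> R \<longrightarrow> \<not> connected_component (- curve S) a b) \<and>
    (\<forall>a b. a \<notin> R \<longrightarrow> b \<notin> R \<longrightarrow> a \<notin> curve S \<longrightarrow> b \<notin> curve S \<longrightarrow> connected_component (- curve S) a b)"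
    for S R
  have "\<exists>R. reg S R" if "face S" for S
    using face_region[OF that] unfolding reg_def by metis
  then obtain R1 R2 R3 where R: "reg S1 R1" "reg S2 R2" "reg S3 R3" using f by meson
  have off: "R \<inter> curve T = {}" if "reg S R" for R S T
    using that unfolding reg_def curve_def by blast
  \<comment> \<open>A region avoids the whole drawing, so it lies on one side of the curve of every
    other face.\<close>
  have sub: "R \<subseteq> R'" if "reg S R" "reg S' R'" "R \<inter> R' \<noteq> {}" for R S S' R'
  proof
    fix x assume x: "x \<in> R"
    obtain z where z: "z \<in> R" "z \<in> R'" using \<open>R \<inter> R' \<noteq> {}\<close> by blast
    have "connected R" "R \<subseteq> - curve S'" using that off by (auto simp: reg_def)
    then have "connected_component (- curve S') z x" using x z unfolding connected_component_def by blast
    then show "x \<in> R'" using that(2) z unfolding reg_def by blast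
  qed
  have disj: "R \<inter> R' = {}" if "reg S R" "reg S' R'" "S \<noteq> S'" "face S" "face S'" for R S S' R'
  proof (rule ccontr)
    assume "R \<inter> R' \<noteq> {}"
    then have "R = R'" using sub[of S R S' R'] sub[of S' R' S R] that by blast
    then have "curve S = curve S'" using that by (auto simp: reg_def)
    then have "p ` S = p ` S'" using curve_verts that by metis
    then show False using inj_p face_facts(1) that by (metis inj_on_image_eq_iff)
  qed
  define q where "q = \<gamma> e (1/2)"
  have qe: "q \<in> path_image (\<gamma> e)" by (simp add: q_def path_image_def)
  have qn: "q \<notin> p ` e"
  proof -
    have "inj_on (\<gamma> e) {0..1}" using arc_\<gamma>[OF e] by (simp add: arc_def)
    then have "q \<noteq> pathstart (\<gamma> e)" "q \<noteq> pathfinish (\<gamma> e)"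
      unfolding q_def pathstart_def pathfinish_def by (auto dest!: inj_onD)
    then show ?thesis using ends_\<gamma>[OF e] by blast
  qed
  define dec where "dec S Q \<longleftrightarrow> compact Q \<and> connected Q \<and> curve S = Q \<union> path_image (\<gamma> e) \<and>
     Q \<inter> path_image (\<gamma> e) = p ` e" for S Q
  have "\<exists>Q. dec S Q" if "face S" "e \<subseteq> S" for S
  proof -
    obtain g c where "arc g" "curve S = path_image g \<union> path_image (\<gamma> e)"
    "path_image g \<inter> path_image (\<gamma> e) = p ` e" using face_decomp[OF \<open>face S\<close> e \<open>e \<subseteq> S\<close>] by metis
    then show ?thesis unfolding dec_def
      by (intro exI[of _ "path_image g"]) (auto simp: compact_arc_image connected_arc_image)
  qed
  then obtain Q1 Q2 Q3 where Q: "dec S1 Q1" "dec S2 Q2" "dec S3 Q3" using f by meson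
  have "closed (Q1 \<union> Q2 \<union> Q3)" using Q by (auto simp: dec_def intro: compact_imp_closed)
  moreover have "q \<notin> Q1 \<union> Q2 \<union> Q3" using Q qe qn unfolding dec_def by blast
  ultimately obtain r where r: "r > 0" "ball q r \<inter> (Q1 \<union> Q2 \<union> Q3) = {}"
    by (metis ComplI open_Compl open_contains_ball disjoint_eq_subset_Compl)
  have "q \<in> frontier R1" "q \<in> frontier R2"
    using R qe e f by (auto simp: reg_def curve_def)
  then obtain a b where ab: "a \<in> ball q r" "a \<in> R1" "b \<in> ball q r" "b \<in> R2"
    using r(1) unfolding frontier_straddle mem_Collect_eq mem_ball by meson
  \<comment> \<open>Janiszewski for \<open>curve S'\<close> and \<open>Q \<union> Q'\<close>, whose
    intersection is the connected set \<open>Q'\<close>. The first does not separate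
    \<open>a\<close> from \<open>b\<close> by assumption, the second does not because the ball
    misses it; their union contains \<open>curve S\<close>.\<close>
  have agree: "connected_component (- curve S) a b"
    if "connected_component (- curve S') a b" "dec S Q" "dec S' Q'" "Q \<subseteq> Q1 \<union> Q2 \<union> Q3" "Q' \<subseteq> Q1 \<union> Q2 \<union> Q3"
    for S Q S' Q'
  proof -
    have "ball q r \<subseteq> - (Q \<union> Q')" using r that by blast
    then have "connected_component (- (Q \<union> Q')) a b"
      unfolding connected_component_def using ab by (intro exI[of _ "ball q r"]) auto
    moreover have "compact (curve S')"
    proof -
      have "curve S' = Q' \<union> path_image (\<gamma> e)" "compact Q'" using that(3) by (auto simp: dec_def)
      then show ?thesis using compact_arc_image[OF arc_\<gamma>[OF e]] compact_Un by metis
    qed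
    moreover have "closed (Q \<union> Q')"
    proof -
      have "compact Q" "compact Q'" using that(2,3) by (auto simp: dec_def)
      then show ?thesis by (simp add: closed_Un compact_imp_closed)
    qed
    moreover have "curve S' \<inter> (Q \<union> Q') = Q'"
    proof -
      have "curve S' = Q' \<union> path_image (\<gamma> e)" "Q \<inter> path_image (\<gamma> e) = p ` e"
        "Q' \<inter> path_image (\<gamma> e) = p ` e" using that(2,3) by (simp_all add: dec_def)
      then show ?thesis by blast
    qed
    ultimately have "connected_component (- (curve S' \<union> (Q \<union> Q'))) a b"
      using Janiszewski[of "curve S'" "Q \<union> Q'" a b] that(1,3) unfolding dec_def by metis
    then show ?thesis
    proof (rule connected_component_of_subset)
      have "curve S = Q \<union> path_image (\<gamma> e)" "curve S' = Q' \<union> path_image (\<gamma> e)"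
        using that(2,3) by (simp_all add: dec_def)
      then show "- (curve S' \<union> (Q \<union> Q')) \<subseteq> - curve S" by blast
    qed
  qed
  have "b \<notin> R1" "a \<notin> R3" "b \<notin> R3" using ab disj R f ne by blast+
  moreover have "a \<notin> curve S3" "b \<notin> curve S3" using off R ab by blast+
  ultimately have "connected_component (- curve S3) a b" using R by (auto simp: reg_def)
  then have "connected_component (- curve S1) a b" using agree[of S3 S1 Q1 Q3] Q by blast
  then show False using \<open>b \<notin> R1\<close> ab R by (auto simp: reg_def)
qed

end

section \<open>Counting faces\<close>

lemma odd_card_sym_diff:
  assumes "finite A" "finite B"
  shows "odd (card ((A - B \<union> (B - A)) \<inter> R)) \<longleftrightarrow> odd (card (A \<inter> R)) \<noteq> odd (card (B \<inter> R))"
proof -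
  have "card (A \<inter> R) = card ((A - B) \<inter> R) + card (A \<inter> B \<inter> R)"
    using assms by (subst card_Un_disjoint[symmetric]) (auto intro: arg_cong[where f = card])
  moreover have "card (B \<inter> R) = card ((B - A) \<inter> R) + card (A \<inter> B \<inter> R)"
    using assms by (subst card_Un_disjoint[symmetric]) (auto intro: arg_cong[where f = card])
  moreover have "card ((A - B \<union> (B - A)) \<inter> R) = card ((A - B) \<inter> R) + card ((B - A) \<inter> R)"
    using assms by (subst card_Un_disjoint[symmetric]) (auto intro: arg_cong[where f = card])
  ultimately show ?thesis by presburger
qed

text \<open>Rank-nullity for the GF(2)-linear map that sends \<open>A\<close> to the set of those
  \<open>S\<close> in \<open>L\<close> with \<open>A \<inter> r S\<close> odd. Each fibre injects
  into the kernel by symmetric difference with a fixed member; the multiplicative form needs no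
  notion of dimension.\<close>

lemma parity_kernel:
  assumes "finite N" "finite L"
  shows "2 ^ card N \<le> 2 ^ card L * card {A. A \<subseteq> N \<and> (\<forall>S\<in>L. even (card (A \<inter> r S)))}"
proof -
  let ?ker = "{A. A \<subseteq> N \<and> (\<forall>S\<in>L. even (card (A \<inter> r S)))}"
  define \<Phi> where "\<Phi> A = {S \<in> L. odd (card (A \<inter> r S))}" for A
  have fink: "finite ?ker" using assms(1) by (rule_tac finite_subset[of _ "Pow N"]) auto
  have fib: "card {A \<in> Pow N. \<Phi> A = X} \<le> card ?ker" for X
  proof (cases "{A \<in> Pow N. \<Phi> A = X} = {}")
    case True
    then show ?thesis by (simp only: card.empty le0)
  next
    case False
    then obtain A0 where A0: "A0 \<subseteq> N" "\<Phi> A0 = X" by blast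
    define f where "f A = A - A0 \<union> (A0 - A)" for A
    show ?thesis
    proof (rule card_inj_on_le[of f])
      show "inj_on f {A \<in> Pow N. \<Phi> A = X}" by (rule inj_onI) (auto simp: f_def)
      show "f ` {A \<in> Pow N. \<Phi> A = X} \<subseteq> ?ker"
      proof (intro image_subsetI)
        fix A assume A: "A \<in> {A \<in> Pow N. \<Phi> A = X}"
        then have "finite A" "finite A0" using A0 assms(1) finite_subset by auto
        note sd = odd_card_sym_diff[OF this]
        have "S \<in> \<Phi> A \<longleftrightarrow> S \<in> \<Phi> A0" for S using A A0 by auto
        then have "even (card (f A \<inter> r S))" if "S \<in> L" for S
          using sd[of "r S"] that unfolding f_def \<Phi>_def by auto
        then show "f A \<in> ?ker" using A A0 by (auto simp: f_def)
      qed
    qed (rule fink)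
  qed
  have fp: "finite (\<Phi> ` Pow N)" using assms(1) by simp
  have "Pow N = (\<Union>X\<in>\<Phi> ` Pow N. {A \<in> Pow N. \<Phi> A = X})" by auto
  then have "card (Pow N) \<le> (\<Sum>X\<in>\<Phi> ` Pow N. card {A \<in> Pow N. \<Phi> A = X})"
    using card_UN_le[OF fp] by metis
  also have "\<dots> \<le> card (\<Phi> ` Pow N) * card ?ker"
    using sum_bounded_above[of "\<Phi> ` Pow N" _ "card ?ker"] fib by simp
  also have "\<dots> \<le> card (Pow L) * card ?ker"
    by (intro mult_right_mono card_mono) (auto simp: \<Phi>_def assms)
  finally show ?thesis using assms by (simp add: card_Pow)
qed

lemma wpar_imp_edge: "wpar K xs \<Longrightarrow> \<exists>e\<in>K. e \<subseteq> set xs"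
proof (induction K xs rule: wpar.induct)
  case (1 K x y zs)
  note IH = 1(1)
  from 1(2) consider "{x, y} \<in> K" | "wpar K (y # zs)" by auto
  then show ?case
  proof cases
    case 1
    then show ?thesis by (intro bexI[of _ "{x, y}"]) auto
  next
    case 2
    then obtain e where "e \<in> K" "e \<subseteq> set (y # zs)" using IH by blast
    then show ?thesis by (intro bexI[of _ e]) auto
  qed
qed auto

context sgraph begin

lemma finite_faces: "finite {S. face S}"
  using finV face_facts(1) by (rule_tac finite_subset[of _ "Pow V"]) auto

text \<open>Since a face is chordless, the parity around it depends on its vertex set alone, which
  links walks to counting.\<close>

lemma face_wpar:
  assumes "cyc c" "face (set c)" "K \<subseteq> E"
  shows "wpar K (c @ [hd c]) \<longleftrightarrow> odd (card {e \<in> K. e \<subseteq> set c})"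
proof -
  have "ledges (c @ [hd c]) = {e \<in> E. e \<subseteq> set c}"
    using cyc_edges[OF assms(1)] assms(2) by (simp add: face_def)
  moreover have "K \<inter> {e \<in> E. e \<subseteq> set c} = {e \<in> K. e \<subseteq> set c}" using assms(3) by auto
  ultimately show ?thesis using wpar_cycle_eq_odd_card[of c K] assms(1) by (simp add: cyc_def)
qed

lemma face_minus_conn:
  assumes "face S" "v \<in> S"
  shows "conn (S - {v})"
proof -
  obtain c where c: "cyc c" "set c = S" "card (nbrs v \<inter> set c) = 2"
    using assms by (auto simp: face_def)
  have "v \<in> set c" using assms(2) c(2) by simp
  then obtain y m z where cy: "cyc (v # y # m @ [z])" and S: "S = {v, y, z} \<union> set m"
    using induced_cyc_at[OF c(1) _ c(3)] c(2) by metis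
  have "successively adj ([v] @ (y # m @ [z]) @ [v])" using cy by (simp add: cyc_def)
  then have "successively adj (y # m @ [z])" by (simp only: successively_append_iff)
  moreover have "S - {v} = set (y # m @ [z])" using S cy by (auto simp: cyc_def)
  ultimately show ?thesis using conn_list[of "y # m @ [z]"] by simp
qed

lemma face_minus_conn2:
  assumes "face S" "v \<in> S" "u \<in> S" "adj v u"
  shows "conn (S - {v, u})"
proof -
  obtain c where c: "cyc c" "set c = S" using assms by (auto simp: face_def)
  have "card (nbrs w \<inter> set c) = 2" if "w \<in> set c" for w using that c assms(1) by (simp add: face_def)
  then obtain d where d: "cyc d" "set d = S" "{v, u} = {hd d, last d}"
    using cyc_close[OF c(1) _ assms(4)] assms c(2) by (metis empty_subsetI insert_subset)
  obtain x y m z where xyz: "d = x # y # m @ [z]"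
  proof -
    obtain x y r where "d = x # y # r" "r \<noteq> []"
      using d(1) by (cases d; cases "tl d"; cases "tl (tl d)") (auto simp: cyc_def)
    then show ?thesis using that[of x y "butlast r" "last r"] by simp
  qed
  have "S - {v, u} = set (y # m)"
  proof -
    have "{v, u} = {x, z}" using d(3) xyz by simp
    then show ?thesis using d(1,2) xyz by (auto simp: cyc_def)
  qed
  moreover have "successively adj (y # m)"
  proof -
    have "successively adj ([x] @ (y # m) @ [z, x])" using d(1) xyz by (simp add: cyc_def)
    then show ?thesis by (simp only: successively_append_iff)
  qed
  ultimately show ?thesis using conn_list[of "y # m"] by simp
qed

lemma face_other_nbr:
  assumes "face S" "u \<in> S"
  obtains w where "w \<in> S" "w \<noteq> v" "adj u w"
proof -
  obtain y z where "nbrs u \<inter> S = {y, z}" "y \<noteq> z"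
    using assms unfolding face_def card_2_iff by blast
  then have "y \<in> S" "z \<in> S" "adj u y" "adj u z" "y \<noteq> v \<or> z \<noteq> v" by (auto simp: nbrs_def)
  then show ?thesis using that by blast
qed

abbreviation star :: "'a \<Rightarrow> 'a set \<Rightarrow> 'a set set" where
  "star v A \<equiv> (\<lambda>a. {v, a}) ` A"

lemma star_subset_E: "A \<subseteq> nbrs v \<Longrightarrow> star v A \<subseteq> E"
  by (auto simp: nbrs_def)

lemma card_star_face:
  assumes "A \<subseteq> nbrs v"
  shows "card {e \<in> star v A. e \<subseteq> S} = (if v \<in> S then card (A \<inter> S) else 0)"
proof (cases "v \<in> S")
  case True
  have "{e \<in> star v A. e \<subseteq> S} = star v (A \<inter> S)" using True by auto
  moreover have "inj_on (\<lambda>a. {v, a}) (A \<inter> S)"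
    by (rule inj_onI) (auto simp: doubleton_eq_iff)
  ultimately show ?thesis using True by (simp add: card_image)
next
  case False
  then have "{e \<in> star v A. e \<subseteq> S} = {}" by auto
  then show ?thesis using False by (simp only: card.empty if_False)
qed

definition faces_at :: "'a \<Rightarrow> 'a set set" where
  "faces_at v = {S. face S \<and> v \<in> S}"

lemma finite_faces_at: "finite (faces_at v)"
  using finite_faces by (rule finite_subset[rotated]) (auto simp: faces_at_def)

end

section \<open>Cuts, and lower bounds on numbers of faces\<close>

context three_connected begin

lemma connV: "conn V"
  using conn3[of "{}"] by simp

lemma even_faces_cut:
  assumes "K \<subseteq> E" "\<And>S. face S \<Longrightarrow> even (card {e \<in> K. e \<subseteq> S})"
  shows "\<exists>Y. \<forall>u w. adj u w \<longrightarrow> ({u, w} \<in> K \<longleftrightarrow> (u \<in> Y) \<noteq> (w \<in> Y))"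
proof -
  have "\<not> unbalanced K V"
  proof
    assume "unbalanced K V"
    then obtain c where "cyc c" "wpar K (c @ [hd c])" "face (set c)" by (rule odd_face)
    then show False using face_wpar assms by blast
  qed
  then obtain Y where "\<And>u v. u \<in> V \<Longrightarrow> v \<in> V \<Longrightarrow> adj u v \<Longrightarrow> {u, v} \<in> K \<longleftrightarrow> (u \<in> Y) \<noteq> (v \<in> Y)"
    using balanced_cut[OF connV] by metis
  then show ?thesis using adjD by (intro exI[of _ Y]) blast
qed

text \<open>All edges of the cut touch \<open>X\<close>, so the connected graph on
  \<open>V - X\<close> contains none of them. It is applied to stars, with \<open>X\<close> the set
  of their one or two centres.\<close>

lemma cut_same_side:
  assumes "\<forall>u w. adj u w \<longrightarrow> ({u, w} \<in> K \<longleftrightarrow> (u \<in> Y) \<noteq> (w \<in> Y))"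
    and "X \<subseteq> V" "card X < 3" "\<And>e. e \<in> K \<Longrightarrow> e \<inter> X \<noteq> {}"
    and ab: "a \<in> V - X" "b \<in> V - X"
  shows "a \<in> Y \<longleftrightarrow> b \<in> Y"
proof -
  have cn: "conn (V - X)" using conn3 assms by blast
  have "q \<in> Y" if pq: "p \<in> V - X" "q \<in> V - X" "p \<in> Y" for p q
  proof (rule ccontr)
    assume "q \<notin> Y"
    then obtain s t where "s \<in> (V - X) \<inter> Y" "t \<in> (V - X) - Y" "adj s t"
      using conn_cross[OF cn pq(1,3,2)] by blast
    then have "{s, t} \<in> K" "{s, t} \<inter> X = {}" using assms(1) by auto
    then show False using assms(4) by blast
  qed
  then show ?thesis using ab by blast
qed

text \<open>For \<open>K = {e}\<close> the odd faces are those through \<open>e\<close>. The odd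
  closed walk off \<open>s\<close> consists of \<open>e = {x, y}\<close>, an edge from
  \<open>x\<close> to a third vertex \<open>z\<close>, and a walk from \<open>z\<close> to
  \<open>y\<close> avoiding \<open>s\<close> and \<open>x\<close>, which therefore cannot use
  \<open>e\<close>.\<close>

lemma face_avoiding:
  assumes "e \<in> E" "s \<in> V" "s \<notin> e"
  obtains S where "face S" "e \<subseteq> S" "s \<notin> S"
proof -
  obtain x y where e: "e = {x, y}" "x \<noteq> y" "adj x y" using edgeE assms by blast
  have xV: "x \<in> V" "y \<in> V" using adjD e by auto
  have "\<not> nbrs x \<subseteq> {s, y}"
    using card_nbrs_ge_3[OF xV(1)] card_mono[of "{s, y}" "nbrs x"] by (auto simp: card_insert_if split: if_splits)
  then obtain z where z: "adj x z" "z \<noteq> s" "z \<noteq> y" by (auto simp: nbrs_def)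
  have zV: "z \<in> V" "z \<noteq> x" using adjD[OF z(1)] by auto
  have "card {s, x} < 3" by (simp add: card_insert_if)
  then have "conn (V - {s, x})" using conn3[of "{s, x}"] assms xV by simp
  then have "(z, y) \<in> (adj_in (V - {s, x}))\<^sup>*"
    using zV z xV e assms by (auto simp: conn_def)
  then obtain b where b: "pw {e} (V - {s, x}) z y b"
    using pw_rtrancl[of z y "V - {s, x}" "{e}"] zV z by auto
  have "\<not> b"
  proof
    assume b
    then obtain xs where "set xs \<subseteq> V - {s, x}" "wpar {e} xs" using b unfolding pw_def by auto
    then show False using wpar_imp_edge[of "{e}" xs] e by auto
  qed
  then have "pw {e} (V - {s}) z y False" using pw_mono[OF b, of "V - {s}"] by auto
  moreover have "pw {e} (V - {s}) x z False"
  proof -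
    have "{x, z} \<notin> {e}" using e z zV by (auto simp: doubleton_eq_iff)
    then show ?thesis using pw_edge[OF z(1), of "V - {s}" "{e}"] xV zV z assms(3) e by auto
  qed
  ultimately have "pw {e} (V - {s}) x y False" using pw_trans by fastforce
  moreover have "pw {e} (V - {s}) x y True"
    using pw_edge[OF e(3), of "V - {s}" "{e}"] xV e(1) assms(3) by auto
  ultimately have "unbalanced {e} (V - {s})" using unbalancedI by blast
  then obtain c where c: "cyc c" "wpar {e} (c @ [hd c])" "face (set c)" "set c \<inter> {s} = {}"
    using odd_face_avoiding[of "{s}"] conn_singleton assms(2) by (metis empty_subsetI insert_subset)
  have "odd (card {e' \<in> {e}. e' \<subseteq> set c})" using face_wpar[OF c(1,3)] c(2) assms(1) by blast
  then have "{e' \<in> {e}. e' \<subseteq> set c} \<noteq> {}" by (metis card.empty even_zero)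
  then have "e \<subseteq> set c" by blast
  then show ?thesis using that c by blast
qed

text \<open>The second face is made to avoid a vertex \<open>t\<close> of the first one, so the two
  differ.\<close>

lemma card_faces_ge_2:
  assumes "e \<in> E"
  shows "2 \<le> card {S. face S \<and> e \<subseteq> S}"
proof -
  have "card e = 2" "e \<subseteq> V" using edge assms by auto
  have "finite e" using \<open>card e = 2\<close> by (metis card.infinite zero_neq_numeral)
  then have "\<not> V \<subseteq> e" using \<open>card e = 2\<close> cardV card_mono[of e V] by auto
  then obtain s where "s \<in> V" "s \<notin> e" by blast
  then obtain S where S: "face S" "e \<subseteq> S" using face_avoiding assms by metis
  have "\<not> S \<subseteq> e"
    using \<open>card e = 2\<close> face_facts(3)[OF S(1)] card_mono[OF \<open>finite e\<close>, of S] by auto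
  then obtain t where t: "t \<in> S" "t \<notin> e" by blast
  then obtain T where T: "face T" "e \<subseteq> T" "t \<notin> T" using face_avoiding assms face_facts(1)[OF S(1)] by blast
  have "card {S, T} = 2" using S T t by (metis card_2_iff)
  moreover have "finite {S. face S \<and> e \<subseteq> S}" using finite_faces by (rule finite_subset[rotated]) auto
  then have "card {S, T} \<le> card {S. face S \<and> e \<subseteq> S}" using S T by (intro card_mono) auto
  ultimately show ?thesis by simp
qed

text \<open>Joining the two neighbours of \<open>v\<close> on each face at \<open>v\<close> gives a
  graph on \<open>nbrs v\<close>, and this is its connectedness. If no face were odd, the edges from
  \<open>v\<close> to \<open>A\<close> would form a cut, although the graph minus \<open>v\<close>
  is connected and contains ends of both chosen and unchosen edges.\<close>

lemma star_splits:
  assumes "v \<in> V" "A \<subseteq> nbrs v" "A \<noteq> {}" "A \<noteq> nbrs v"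
  shows "\<exists>S\<in>faces_at v. odd (card (A \<inter> S))"
proof (rule ccontr)
  assume no: "\<not> ?thesis"
  have "even (card {e \<in> star v A. e \<subseteq> S})" if "face S" for S
    using card_star_face[OF assms(2), of S] no that by (auto simp: faces_at_def)
  then obtain Y where Y: "\<forall>u w. adj u w \<longrightarrow> ({u, w} \<in> star v A \<longleftrightarrow> (u \<in> Y) \<noteq> (w \<in> Y))"
    using even_faces_cut[OF star_subset_E[OF assms(2)]] by blast
  obtain a b where a: "a \<in> A" and b: "b \<in> nbrs v" "b \<notin> A" using assms by blast
  have av: "a \<in> V" "b \<in> V" "a \<noteq> v" "b \<noteq> v" "adj v a" "adj v b"
    using nbrs_subset[of v] a b assms by (auto simp: nbrs_def)
  have "a \<in> Y \<longleftrightarrow> b \<in> Y"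
  proof (rule cut_same_side[OF Y])
    show "{v} \<subseteq> V" "card {v} < 3" "a \<in> V - {v}" "b \<in> V - {v}" using av assms(1) by auto
    show "e \<inter> {v} \<noteq> {}" if "e \<in> star v A" for e using that by blast
  qed
  moreover have "{v, a} \<in> star v A" using a by auto
  moreover have "{v, b} \<notin> star v A" using b by (auto simp: doubleton_eq_iff)
  ultimately show False using Y[rule_format, OF av(5)] Y[rule_format, OF av(6)] by simp
qed

text \<open>The kernel of the map from edge sets to parities on faces consists of cuts, and a cut is
  given by its side without a fixed vertex \<open>r\<close>; this leaves at most 2^(|V|-1) kernel
  elements for rank-nullity.\<close>

lemma edges_le_faces: "card E + 1 \<le> card {S. face S} + card V"
proof -
  let ?ker = "{K. K \<subseteq> E \<and> (\<forall>S\<in>{S. face S}. even (card (K \<inter> {e. e \<subseteq> S})))}"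
  obtain r where r: "r \<in> V" using cardV by fastforce
  define \<delta> where "\<delta> Y = {e \<in> E. \<exists>u v. e = {u, v} \<and> u \<in> Y \<and> v \<notin> Y}" for Y
  have "?ker \<subseteq> \<delta> ` Pow (V - {r})"
  proof
    fix K assume K: "K \<in> ?ker"
    then have KE: "K \<subseteq> E" and ev: "\<And>S. face S \<Longrightarrow> even (card {e \<in> K. e \<subseteq> S})"
      by (auto simp: Int_def)
    obtain Y where Y: "\<forall>u w. adj u w \<longrightarrow> ({u, w} \<in> K \<longleftrightarrow> (u \<in> Y) \<noteq> (w \<in> Y))"
      using even_faces_cut[OF KE ev] by blast
    \<comment> \<open>Both sides describe the same cut; choosing the one without \<open>r\<close>
      saves the factor 2 behind the summand 1 of the bound.\<close>
    define Y' where "Y' = (if r \<in> Y then V - Y else V \<inter> Y)"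
    have Y': "{u, v} \<in> K \<longleftrightarrow> (u \<in> Y') \<noteq> (v \<in> Y')" if "adj u v" for u v
      using Y that adjD[OF that] by (auto simp: Y'_def)
    have "K = \<delta> Y'"
    proof (intro equalityI subsetI)
      fix e assume e: "e \<in> K"
      then have "e \<in> E" using KE by blast
      then obtain u v where uv: "e = {u, v}" "adj u v" by (rule edgeE)
      then have "(u \<in> Y') \<noteq> (v \<in> Y')" using Y' e by simp
      then show "e \<in> \<delta> Y'" using uv unfolding \<delta>_def by (auto simp: insert_commute)
    next
      fix e assume "e \<in> \<delta> Y'"
      then obtain u v where "e \<in> E" "e = {u, v}" "u \<in> Y'" "v \<notin> Y'" by (auto simp: \<delta>_def)
      then show "e \<in> K" using Y'[of u v] by simp
    qed
    moreover have "Y' \<subseteq> V - {r}" by (auto simp: Y'_def)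
    ultimately show "K \<in> \<delta> ` Pow (V - {r})" by blast
  qed
  then have "card ?ker \<le> card (\<delta> ` Pow (V - {r}))" by (intro card_mono) (simp_all add: finV)
  also have "\<dots> \<le> card (Pow (V - {r}))" by (intro card_image_le) (simp add: finV)
  also have "\<dots> = 2 ^ (card V - 1)" using r finV by (simp add: card_Pow)
  finally have "2 ^ card {S. face S} * card ?ker \<le> 2 ^ card {S. face S} * 2 ^ (card V - 1)" by simp
  with parity_kernel[OF finE finite_faces]
  have "2 ^ card E \<le> 2 ^ card {S. face S} * (2::nat) ^ (card V - 1)" by (rule order.trans)
  then have "(2::nat) ^ card E \<le> 2 ^ (card {S. face S} + (card V - 1))" by (simp add: power_add)
  then show ?thesis using cardV by simp
qed

end

section \<open>Incidences of faces with edges and vertices in the plane\<close>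

context plane_graph begin

lemma card_faces_at_edge:
  assumes "e \<in> E"
  shows "card {S. face S \<and> e \<subseteq> S} = 2"
proof (rule antisym)
  show "2 \<le> card {S. face S \<and> e \<subseteq> S}" using card_faces_ge_2[OF assms] .
  show "card {S. face S \<and> e \<subseteq> S} \<le> 2"
  proof (rule ccontr)
    assume "\<not> ?thesis"
    then have "3 \<le> card {S. face S \<and> e \<subseteq> S}" by simp
    then obtain T where "T \<subseteq> {S. face S \<and> e \<subseteq> S}" "card T = 3" "finite T"
      by (rule obtain_subset_with_card_n)
    then obtain S1 S2 S3 where "{S1, S2, S3} \<subseteq> {S. face S \<and> e \<subseteq> S}" "S1 \<noteq> S2" "S2 \<noteq> S3" "S1 \<noteq> S3"
      by (metis card_3_iff)
    then show False using no_three_faces_at_edge[OF assms, of S1 S2 S3] by blast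
  qed
qed

lemma card_faces_at_nbr:
  assumes "u \<in> nbrs v"
  shows "card {S \<in> faces_at v. u \<in> S} = 2"
proof -
  have "{S \<in> faces_at v. u \<in> S} = {S. face S \<and> {v, u} \<subseteq> S}" by (auto simp: faces_at_def)
  then show ?thesis using card_faces_at_edge[of "{v, u}"] assms by (simp add: nbrs_def)
qed

lemma sum_card_faces_at:
  assumes "A \<subseteq> nbrs v"
  shows "(\<Sum>S\<in>faces_at v. card (A \<inter> S)) = 2 * card A"
proof -
  have "finite A" using assms nbrs_subset finite_subset by metis
  have "(\<Sum>S\<in>faces_at v. card {u \<in> A. u \<in> S}) = (\<Sum>u\<in>A. 2)"
    by (rule sum_multicount_gen) (use finite_faces_at \<open>finite A\<close> card_faces_at_nbr assms in auto)
  then show ?thesis by (simp add: Int_def)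
qed

text \<open>Double counting: each neighbour of \<open>v\<close> lies on two faces at
  \<open>v\<close>, and each such face contains two neighbours.\<close>

lemma card_faces_at: "card (faces_at v) = card (nbrs v)"
proof -
  have "(\<Sum>S\<in>faces_at v. card (nbrs v \<inter> S)) = (\<Sum>S\<in>faces_at v. 2)"
    by (rule sum.cong) (auto simp: faces_at_def face_def)
  then show ?thesis using sum_card_faces_at[of "nbrs v" v] by simp
qed

text \<open>The subsets of the neighbourhood that meet every other face evenly number at least four by
  counting, so one of them is nontrivial. It meets an odd face, and it meets an even number of
  them, because each neighbour lies on two faces.\<close>

lemma star_splits_two:
  assumes "S \<in> faces_at x" "S' \<in> faces_at x" "S \<noteq> S'"
  shows "\<exists>A\<subseteq>nbrs x. odd (card (A \<inter> S)) \<and> odd (card (A \<inter> S')) \<and>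
    (\<forall>T\<in>faces_at x - {S, S'}. even (card (A \<inter> T)))"
proof -
  have xV: "x \<in> V" using assms(1) face_facts by (auto simp: faces_at_def)
  define L where "L = faces_at x - {S, S'}"
  have fL: "finite L" using finite_faces_at by (simp add: L_def)
  have fa: "faces_at x = insert S (insert S' L)" using assms by (auto simp: L_def)
  have "card (faces_at x) = card L + 2"
    unfolding fa using fL assms(3) by (simp add: L_def)
  then have d: "card (nbrs x) = card L + 2" by (simp add: card_faces_at)
  let ?ker = "{A. A \<subseteq> nbrs x \<and> (\<forall>T\<in>L. even (card (A \<inter> T)))}"
  have "2 ^ card (nbrs x) \<le> 2 ^ card L * card ?ker"
    using parity_kernel[OF nbrs_subset(3) fL, of x "\<lambda>T. T"] by simp
  then have "4 \<le> card ?ker" by (simp add: d power_add)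
  moreover have "card {{}, nbrs x} \<le> 2" by (simp add: card_insert_if)
  ultimately have "\<not> ?ker \<subseteq> {{}, nbrs x}"
    using card_mono[of "{{}, nbrs x}" ?ker] by auto
  then obtain A where A: "A \<subseteq> nbrs x" "\<forall>T\<in>L. even (card (A \<inter> T))" "A \<noteq> {}" "A \<noteq> nbrs x" by blast
  obtain T where T: "T \<in> faces_at x" "odd (card (A \<inter> T))" using star_splits[OF xV A(1,3,4)] by blast
  have "2 * card A = card (A \<inter> S) + (card (A \<inter> S') + (\<Sum>T\<in>L. card (A \<inter> T)))"
    using sum_card_faces_at[OF A(1)] fL assms(3) unfolding fa by (simp add: L_def)
  moreover have "even (\<Sum>T\<in>L. card (A \<inter> T))" using A(2) by (intro dvd_sum) auto
  ultimately have "odd (card (A \<inter> S)) \<longleftrightarrow> odd (card (A \<inter> S'))" by presburger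
  then have "odd (card (A \<inter> S))" "odd (card (A \<inter> S'))" using T A(2) fa by auto
  then show ?thesis using A(1,2) unfolding L_def by blast
qed

text \<open>Otherwise choose edges at v and at x, in each case so that exactly the two given faces use an odd
  number of them. Every face then has an even number of chosen edges, so they form a cut;
  but G - {v, x} is connected.\<close>

lemma common_vertices_adj:
  assumes "face S" "face S'" "S \<noteq> S'" "v \<in> S" "v \<in> S'" "x \<in> S" "x \<in> S'" "v \<noteq> x"
  shows "adj v x"
proof (rule ccontr)
  assume nadj: "\<not> adj v x"
  have V: "v \<in> V" "x \<in> V" using assms face_facts by auto
  have fs: "S \<in> faces_at v" "S' \<in> faces_at v" "S \<in> faces_at x" "S' \<in> faces_at x"
    using assms by (auto simp: faces_at_def)
  obtain A where A: "A \<subseteq> nbrs v" "odd (card (A \<inter> S))" "odd (card (A \<inter> S'))"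
    "\<forall>T\<in>faces_at v - {S, S'}. even (card (A \<inter> T))"
    using star_splits_two[OF fs(1,2) assms(3)] by blast
  obtain B where B: "B \<subseteq> nbrs x" "odd (card (B \<inter> S))" "odd (card (B \<inter> S'))"
    "\<forall>T\<in>faces_at x - {S, S'}. even (card (B \<inter> T))"
    using star_splits_two[OF fs(3,4) assms(3)] by blast
  have fin: "finite A" "finite B" using A B nbrs_subset finite_subset by metis+
  let ?K = "star v A \<union> star x B"
  have disj: "star v A \<inter> star x B = {}"
    using A(1) nadj assms(8) by (auto simp: doubleton_eq_iff nbrs_def)
  have KE: "?K \<subseteq> E" using star_subset_E A B by (metis Un_subset_iff)
  have ev: "even (card {e \<in> ?K. e \<subseteq> T})" if "face T" for T
  proof -
    have "{e \<in> ?K. e \<subseteq> T} = {e \<in> star v A. e \<subseteq> T} \<union> {e \<in> star x B. e \<subseteq> T}" by auto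
    then have "card {e \<in> ?K. e \<subseteq> T} = card {e \<in> star v A. e \<subseteq> T} + card {e \<in> star x B. e \<subseteq> T}"
    proof (elim ssubst, intro card_Un_disjoint)
      show "finite {e \<in> star v A. e \<subseteq> T}" "finite {e \<in> star x B. e \<subseteq> T}" using fin by simp_all
      show "{e \<in> star v A. e \<subseteq> T} \<inter> {e \<in> star x B. e \<subseteq> T} = {}" using disj by blast
    qed
    then have *: "card {e \<in> ?K. e \<subseteq> T} =
        (if v \<in> T then card (A \<inter> T) else 0) + (if x \<in> T then card (B \<inter> T) else 0)"
      by (simp only: card_star_face[OF A(1)] card_star_face[OF B(1)])
    show ?thesis
    proof (cases "T = S \<or> T = S'")
      case True
      then show ?thesis using * A B assms by auto
    next
      case False
      have "even (card (A \<inter> T))" if "v \<in> T" using A(4) False that \<open>face T\<close> by (auto simp: faces_at_def)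
      moreover have "even (card (B \<inter> T))" if "x \<in> T" using B(4) False that \<open>face T\<close> by (auto simp: faces_at_def)
      ultimately show ?thesis using * by auto
    qed
  qed
  obtain Y where Y: "\<forall>u w. adj u w \<longrightarrow> ({u, w} \<in> ?K \<longleftrightarrow> (u \<in> Y) \<noteq> (w \<in> Y))"
    using even_faces_cut[OF KE ev] by blast
  have "A \<inter> S \<noteq> {}" using A(2) by auto
  then obtain a where a: "a \<in> A" by blast
  \<comment> \<open>The face \<open>S\<close> contains exactly two neighbours of \<open>v\<close>,
    whereas it meets \<open>A\<close> in an odd number.\<close>
  have "A \<noteq> nbrs v" using A(2) assms by (auto simp: face_def)
  then obtain b where b: "b \<in> nbrs v" "b \<notin> A" using A by blast
  have av: "adj v a" "adj v b" using a b A by (auto simp: nbrs_def)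
  have ne: "a \<noteq> x" "b \<noteq> x" using av nadj by auto
  have "a \<in> Y \<longleftrightarrow> b \<in> Y"
  proof (rule cut_same_side[OF Y])
    show "{v, x} \<subseteq> V" "card {v, x} < 3" using V by (auto simp: card_insert_if)
    show "a \<in> V - {v, x}" "b \<in> V - {v, x}" using adjD[OF av(1)] adjD[OF av(2)] ne by auto
    show "e \<inter> {v, x} \<noteq> {}" if "e \<in> ?K" for e using that by blast
  qed
  moreover have "{v, a} \<in> ?K" using a by blast
  moreover have "{v, b} \<notin> ?K"
  proof -
    have "{v, b} \<noteq> {v, a'}" if "a' \<in> A" for a' using b that by (auto simp: doubleton_eq_iff)
    moreover have "{v, b} \<noteq> {x, b'}" for b' using ne assms(8) by (auto simp: doubleton_eq_iff)
    ultimately show ?thesis by blast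
  qed
  ultimately show False using Y[rule_format, OF av(1)] Y[rule_format, OF av(2)] by simp
qed

end

section \<open>The wheel around a vertex\<close>

context plane_graph begin

text \<open>The rim is cut into three pieces without ordering the faces cyclically. Only the two
  faces \<open>S1\<close>, \<open>S2\<close> at one spoke are singled out and all others are merged
  into \<open>B3\<close>. The price is that connectedness of \<open>B3\<close> needs an argument;
  parity supplies it.\<close>

lemma wheel_model:
  assumes v: "v \<in> V"
  obtains B1 B2 B3 where
    "conn B1" "conn B2" "conn B3" "v \<notin> B1 \<union> B2 \<union> B3"
    "B1 \<inter> B2 = {}" "B1 \<inter> B3 = {}" "B2 \<inter> B3 = {}"
    "B1 \<union> B2 \<union> B3 \<subseteq> (\<Union>S\<in>faces_at v. S - {v})"
    "\<exists>b\<in>B1. adj v b" "\<exists>b\<in>B2. adj v b" "\<exists>b\<in>B3. adj v b"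
    "\<exists>a\<in>B1. \<exists>b\<in>B2. adj a b" "\<exists>a\<in>B2. \<exists>b\<in>B3. adj a b" "\<exists>a\<in>B3. \<exists>b\<in>B1. adj a b"
proof -
  note goal = that
  let ?N = "nbrs v"
  have d3: "card ?N \<ge> 3" using card_nbrs_ge_3 v by blast
  have nonsub: "\<not> ?N \<subseteq> {a, b}" for a b
    using d3 card_mono[of "{a, b}" ?N] by (auto simp: card_insert_if split: if_splits)
  have share: "x \<in> ?N" if "S \<in> faces_at v" "T \<in> faces_at v" "S \<noteq> T" "x \<in> S" "x \<in> T" "x \<noteq> v" for S T x
    using common_vertices_adj[of S T v x] that by (auto simp: faces_at_def nbrs_def)
  have pair: "\<exists>S T. {S \<in> faces_at v. u \<in> S} = {S, T} \<and> S \<noteq> T" if "u \<in> ?N" for u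
    using card_faces_at_nbr[OF that] by (auto simp: card_2_iff)
  have ends: "\<exists>s t. ?N \<inter> S = {s, t} \<and> s \<noteq> t" if "S \<in> faces_at v" for S
    using that by (simp add: faces_at_def face_def card_2_iff)
  have fv: "face S" "v \<in> S" if "S \<in> faces_at v" for S
    using that by (auto simp: faces_at_def)
  obtain u2 where u2: "u2 \<in> ?N" using nonsub by blast
  obtain S1 S2 where S12: "{S \<in> faces_at v. u2 \<in> S} = {S1, S2}" "S1 \<noteq> S2" using pair[OF u2] by blast
  have S1: "S1 \<in> faces_at v" "u2 \<in> S1" and S2: "S2 \<in> faces_at v" "u2 \<in> S2" using S12(1) by blast+
  have only2: "S = S1 \<or> S = S2" if "S \<in> faces_at v" "u2 \<in> S" for S using S12(1) that by blast
  obtain u1 where u1: "?N \<inter> S1 = {u1, u2}" "u1 \<noteq> u2"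
    using ends[OF S1(1)] u2 S1(2) by (metis Int_iff insertE insert_commute singletonD)
  obtain u3 where u3: "?N \<inter> S2 = {u2, u3}" "u3 \<noteq> u2"
    using ends[OF S2(1)] u2 S2(2) by (metis Int_iff insertE insert_commute singletonD)
  have uN: "u1 \<in> ?N" "u3 \<in> ?N" "u1 \<in> S1" "u3 \<in> S2" using u1 u3 by blast+
  \<comment> \<open>Otherwise \<open>S1\<close> and \<open>S2\<close> alone would close up around
    \<open>v\<close>, and no face would split \<open>{u1, u2}\<close> from the remaining
    neighbours.\<close>
  have u13: "u1 \<noteq> u3"
  proof
    assume eq: "u1 = u3"
    have A: "{u1, u2} \<subseteq> ?N" "{u1, u2} \<noteq> {}" "{u1, u2} \<noteq> ?N" using u2 uN nonsub[of u1 u2] by auto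
    have "{S1, S2} = {S \<in> faces_at v. u1 \<in> S}"
    proof (rule card_subset_eq)
      show "finite {S \<in> faces_at v. u1 \<in> S}" using finite_faces_at by simp
      show "{S1, S2} \<subseteq> {S \<in> faces_at v. u1 \<in> S}" using S1 S2 uN eq by auto
      show "card {S1, S2} = card {S \<in> faces_at v. u1 \<in> S}" using card_faces_at_nbr[OF uN(1)] S12(2) by simp
    qed
    then have only1: "S \<in> {S1, S2}" if "S \<in> faces_at v" "u1 \<in> S" for S using that by simp
    have "even (card ({u1, u2} \<inter> S))" if "S \<in> faces_at v" for S
    proof (cases "S = S1 \<or> S = S2")
      case True
      then have "{u1, u2} \<inter> S = {u1, u2}" using S1 S2 uN eq by auto
      then show ?thesis using u1(2) by simp
    next
      case False
      then have "{u1, u2} \<inter> S = {}" using only1 only2 that by blast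
      then show ?thesis by simp
    qed
    then show False using star_splits[OF v A] by blast
  qed
  have nin: "u1 \<notin> S2" "u3 \<notin> S1"
  proof -
    have "u1 \<notin> ?N \<inter> S2" unfolding u3(1) using u1(2) u13 by simp
    then show "u1 \<notin> S2" using uN by simp
    have "u3 \<notin> ?N \<inter> S1" unfolding u1(1) using u3(2) u13 by simp
    then show "u3 \<notin> S1" using uN by simp
  qed
  have vu: "v \<noteq> u1" "v \<noteq> u2" "v \<noteq> u3" using nbrs_subset(2)[of v] u2 uN by blast+
  have adjv: "adj v u1" "adj v u2" "adj v u3" using u2 uN by (auto simp: nbrs_def)
  define L where "L = faces_at v - {S1, S2}"
  \<comment> \<open>Consecutive pieces share the end of a spoke; \<open>u1\<close> is given to
    \<open>B1\<close>, \<open>u2\<close> to \<open>B2\<close> and \<open>u3\<close> to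
    \<open>B3\<close>.\<close>
  define B1 where "B1 = S1 - {v, u2}"
  define B2 where "B2 = S2 - {v, u3}"
  define B3 where "B3 = (\<Union>S\<in>L. S - {v}) - {u1}"
  have LF: "S \<in> faces_at v" "S \<noteq> S1" "S \<noteq> S2" "u2 \<notin> S" if "S \<in> L" for S
    using that only2 by (auto simp: L_def)
  obtain T1 where T1: "T1 \<in> L" "u1 \<in> T1"
  proof -
    obtain T T' where "{S \<in> faces_at v. u1 \<in> S} = {T, T'}" "T \<noteq> T'" using pair[OF uN(1)] by blast
    then have "\<exists>T1 \<in> faces_at v. u1 \<in> T1 \<and> T1 \<noteq> S1" by blast
    then show ?thesis using that nin(1) unfolding L_def by blast
  qed
  have T1u: "S = T1" if "S \<in> L" "u1 \<in> S" for S
  proof -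
    obtain T T' where "{S \<in> faces_at v. u1 \<in> S} = {T, T'}" using pair[OF uN(1)] by blast
    moreover have "S1 \<in> {S \<in> faces_at v. u1 \<in> S}" using S1 uN by simp
    moreover have "T1 \<in> {S \<in> faces_at v. u1 \<in> S}" "S1 \<noteq> T1" using T1 LF by blast+
    moreover have "S \<in> {S \<in> faces_at v. u1 \<in> S}" "S1 \<noteq> S" using that LF by blast+
    ultimately have "S1 \<in> {T, T'}" "T1 \<in> {T, T'}" "S \<in> {T, T'}" "S1 \<noteq> T1" "S1 \<noteq> S" by simp_all
    then show ?thesis by auto
  qed
  obtain T3 where T3: "T3 \<in> L" "u3 \<in> T3"
  proof -
    obtain T T' where "{S \<in> faces_at v. u3 \<in> S} = {T, T'}" "T \<noteq> T'" using pair[OF uN(2)] by blast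
    then have "\<exists>T1 \<in> faces_at v. u3 \<in> T1 \<and> T1 \<noteq> S2" by blast
    then show ?thesis using that nin(2) unfolding L_def by blast
  qed
  have u3B: "u3 \<in> B3" using T3 vu u13 by (auto simp: B3_def)
  have u2B: "u2 \<notin> B3" using LF by (auto simp: B3_def)
  \<comment> \<open>The spokes that can be reached from \<open>u3\<close> within \<open>B3\<close>;
    the goal is that only \<open>u1\<close> and \<open>u2\<close> are missing.\<close>
  define A' where "A' = {u \<in> ?N \<inter> B3. (u3, u) \<in> (adj_in B3)\<^sup>*}"
  have A'N: "A' \<subseteq> ?N" "u1 \<notin> A'" "u2 \<notin> A'" "u3 \<in> A'"
    using u2B u3B uN by (auto simp: A'_def B3_def)
  have part: "conn (T - {v, u1})" "T - {v, u1} \<subseteq> B3" if "T \<in> L" for T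
  proof -
    show "T - {v, u1} \<subseteq> B3" using that by (auto simp: B3_def)
    have "conn (T - {v})" using face_minus_conn fv[OF LF(1)[OF that]] by blast
    moreover have "T - {v, u1} = T - {v}" if "u1 \<notin> T" using that by auto
    moreover have "conn (T - {v, u1})" if "u1 \<in> T"
      using face_minus_conn2 fv[OF LF(1)[OF \<open>T \<in> L\<close>]] that adjv by blast
    ultimately show "conn (T - {v, u1})" by (cases "u1 \<in> T") auto
  qed
  have reach: "y \<in> B3 \<and> (u3, y) \<in> (adj_in B3)\<^sup>*"
    if "T \<in> L" "x \<in> A'" "x \<in> T" "y \<in> T - {v, u1}" for T x y
  proof -
    have "x \<in> T - {v, u1}" using that A'N nbrs_subset(2)[of v] by blast
    then have "(x, y) \<in> (adj_in (T - {v, u1}))\<^sup>*" using part(1)[OF that(1)] that(4) by (simp add: conn_def)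
    then have "(x, y) \<in> (adj_in B3)\<^sup>*" using adj_in_mono[OF part(2)[OF that(1)]] by blast
    moreover have "(u3, x) \<in> (adj_in B3)\<^sup>*" using that(2) by (simp add: A'_def)
    ultimately show ?thesis using part(2)[OF that(1)] that(4) by (auto intro: rtrancl_trans)
  qed
  have closed: "card (A' \<inter> T) = 0 \<or> card (A' \<inter> T) = 2" if "T \<in> L" "u1 \<notin> T" for T
  proof (cases "A' \<inter> T = {}")
    case False
    then obtain x where x: "x \<in> A'" "x \<in> T" by blast
    have "?N \<inter> T \<subseteq> A' \<inter> T"
    proof
      fix y assume y: "y \<in> ?N \<inter> T"
      then have "y \<in> T - {v, u1}" using that nbrs_subset(2)[of v] by auto
      then show "y \<in> A' \<inter> T" using reach[OF that(1) x] y by (simp add: A'_def)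
    qed
    then have "A' \<inter> T = ?N \<inter> T" using A'N by blast
    then show ?thesis using fv[OF LF(1)[OF that(1)]] by (simp add: face_def)
  qed simp
  have A'S1: "A' \<inter> S1 = {}"
  proof -
    have "A' \<inter> S1 \<subseteq> {u1, u2}" using A'N(1) unfolding u1(1)[symmetric] by blast
    then show ?thesis using A'N(2,3) by blast
  qed
  have A'S2: "A' \<inter> S2 = {u3}"
  proof -
    have "A' \<inter> S2 \<subseteq> {u2, u3}" using A'N(1) unfolding u3(1)[symmetric] by blast
    then show ?thesis using A'N(3,4) uN(4) by blast
  qed
  define L' where "L' = L - {T1}"
  have fa: "faces_at v = insert S1 (insert S2 (insert T1 L'))"
    using S1 S2 T1 by (auto simp: L_def L'_def)
  have fL: "finite L'" "S1 \<noteq> T1" "S2 \<noteq> T1" "S1 \<notin> L'" "S2 \<notin> L'" "T1 \<notin> L'"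
    using finite_faces_at T1 by (auto simp: L_def L'_def)
  \<comment> \<open>A handshake argument: incidences of \<open>A'\<close> with faces at
    \<open>v\<close> number \<open>2 * card A'\<close>. \<open>S2\<close> contributes one,
    \<open>S1\<close> none, and every face other than these and \<open>T1\<close> an even number, so
    the chain of faces from \<open>u3\<close> must end in \<open>T1\<close>.\<close>
  have "A' \<inter> T1 \<noteq> {}"
  proof
    assume e: "A' \<inter> T1 = {}"
    have "2 * card A' = card (A' \<inter> S1) + (card (A' \<inter> S2) + (card (A' \<inter> T1) + (\<Sum>T\<in>L'. card (A' \<inter> T))))"
      using sum_card_faces_at[OF A'N(1)] fL S12(2) unfolding fa by simp
    moreover have "even (\<Sum>T\<in>L'. card (A' \<inter> T))"
    proof (rule dvd_sum)
      fix T assume "T \<in> L'"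
      then have "T \<in> L" "u1 \<notin> T" using T1u by (auto simp: L'_def)
      then show "even (card (A' \<inter> T))" using closed by fastforce
    qed
    ultimately show False unfolding e A'S1 A'S2 by simp presburger
  qed
  then obtain s where s: "s \<in> A'" "s \<in> T1" by blast
  \<comment> \<open>Adding \<open>u1\<close> and \<open>u2\<close> closes the chain: every face at
    \<open>v\<close> then contains none or two of these vertices, and \<open>star_splits\<close>
    leaves only the whole neighbourhood.\<close>
  have NA': "?N = A' \<union> {u1, u2}"
  proof (rule ccontr)
    assume ne: "?N \<noteq> A' \<union> {u1, u2}"
    let ?A = "A' \<union> {u1, u2}"
    have "even (card (?A \<inter> T))" if T: "T \<in> faces_at v" for T
    proof -
      have two: "card {a, b} = 2" if "a \<noteq> b" for a b :: 'a using that by simp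
      consider "T = S1" | "T = S2" | "T = T1" | "T \<in> L" "T \<noteq> T1"
        using T fa unfolding L'_def by blast
      then show ?thesis
      proof cases
        case 1
        then have "?A \<inter> T = {u1, u2}" using A'S1 S1 uN by blast
        then show ?thesis using two[OF u1(2)] by simp
      next
        case 2
        then have "?A \<inter> T = {u2, u3}" using A'S2 S2 nin by blast
        then show ?thesis using two[OF u3(2)[symmetric]] by simp
      next
        case 3
        obtain a b where ab: "?N \<inter> T1 = {a, b}" "a \<noteq> b" using ends LF(1)[OF T1(1)] by blast
        have "s \<in> ?N" "s \<noteq> u1" using s A'N by blast+
        then have "s \<in> {a, b}" "u1 \<in> {a, b}" using T1(2) s(2) uN(1) unfolding ab(1)[symmetric] by simp_all
        then have su: "?N \<inter> T1 = {s, u1}" using ab \<open>s \<noteq> u1\<close> by auto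
        then have "?A \<inter> T = {s, u1}" using 3 s T1(2) A'N u2 LF(4)[OF T1(1)] by blast
        then show ?thesis using two[OF \<open>s \<noteq> u1\<close>] by simp
      next
        case 4
        then have "u1 \<notin> T" using T1u by blast
        then have "?A \<inter> T = A' \<inter> T" using LF(4)[OF 4(1)] by blast
        then show ?thesis using closed[OF 4(1) \<open>u1 \<notin> T\<close>] by auto
      qed
    qed
    then show False using star_splits[OF v, of ?A] A'N(1) u2 uN ne by blast
  qed
  have conn3: "conn B3"
  proof (rule connI_root[OF u3B])
    fix y assume "y \<in> B3"
    then obtain T where T: "T \<in> L" "y \<in> T - {v, u1}" by (auto simp: B3_def)
    obtain a b where ab: "?N \<inter> T = {a, b}" "a \<noteq> b" using ends LF(1)[OF T(1)] by blast
    then obtain t where "t \<in> ?N" "t \<in> T" "t \<noteq> u1" by blast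
    moreover have "t \<noteq> u2" using LF(4)[OF T(1)] \<open>t \<in> T\<close> by blast
    ultimately have "t \<in> A'" using NA' by blast
    then show "(u3, y) \<in> (adj_in B3)\<^sup>*" using reach[OF T(1) _ \<open>t \<in> T\<close> T(2)] by blast
  qed
  show ?thesis
  proof (rule goal[of B1 B2 B3])
    show "conn B1" unfolding B1_def using face_minus_conn2 fv[OF S1(1)] S1(2) adjv by blast
    show "conn B2" unfolding B2_def using face_minus_conn2 fv[OF S2(1)] uN(4) adjv by blast
    show "conn B3" by (rule conn3)
    show "v \<notin> B1 \<union> B2 \<union> B3" by (auto simp: B1_def B2_def B3_def)
    show "B1 \<union> B2 \<union> B3 \<subseteq> (\<Union>S\<in>faces_at v. S - {v})"
      using S1(1) S2(1) LF(1) unfolding B1_def B2_def B3_def by blast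
    show "B1 \<inter> B2 = {}"
    proof (rule ccontr)
      assume "B1 \<inter> B2 \<noteq> {}"
      then obtain x where x: "x \<in> S1" "x \<in> S2" "x \<noteq> v" "x \<noteq> u2" by (auto simp: B1_def B2_def)
      then have "x \<in> ?N \<inter> S1" "x \<in> ?N \<inter> S2" using share[OF S1(1) S2(1) S12(2)] by blast+
      then show False using u1 u3 u13 x by auto
    qed
    show "B1 \<inter> B3 = {}"
    proof (rule ccontr)
      assume "B1 \<inter> B3 \<noteq> {}"
      then obtain x T where x: "x \<in> S1" "T \<in> L" "x \<in> T" "x \<noteq> v" "x \<noteq> u2" "x \<noteq> u1"
        by (auto simp: B1_def B3_def)
      then have "x \<in> ?N \<inter> S1" using share[OF S1(1) LF(1)[OF x(2)]] LF(2)[OF x(2)] by blast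
      then show False using u1 x by auto
    qed
    show "B2 \<inter> B3 = {}"
    proof (rule ccontr)
      assume "B2 \<inter> B3 \<noteq> {}"
      then obtain x T where x: "x \<in> S2" "T \<in> L" "x \<in> T" "x \<noteq> v" "x \<noteq> u3"
        by (auto simp: B2_def B3_def)
      then have "x \<in> ?N \<inter> S2" using share[OF S2(1) LF(1)[OF x(2)]] LF(3)[OF x(2)] by blast
      then show False using u3 x LF(4)[OF x(2)] by auto
    qed
    have b: "u1 \<in> B1" "u2 \<in> B2" using uN S2 u1(2) u3(2) vu by (auto simp: B1_def B2_def)
    then show "\<exists>b\<in>B1. adj v b" "\<exists>b\<in>B2. adj v b" "\<exists>b\<in>B3. adj v b" using adjv u3B by blast+
    obtain w where w: "w \<in> S1" "w \<noteq> v" "adj u2 w" using face_other_nbr fv(1)[OF S1(1)] S1(2) by metis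
    then have "w \<in> B1" using adjD[OF w(3)] by (auto simp: B1_def)
    then show "\<exists>a\<in>B1. \<exists>b\<in>B2. adj a b" using b(2) adj_sym[OF w(3)] by blast
    obtain w' where w': "w' \<in> S2" "w' \<noteq> v" "adj u3 w'" using face_other_nbr fv(1)[OF S2(1)] uN(4) by metis
    then have "w' \<in> B2" using adjD[OF w'(3)] by (auto simp: B2_def)
    then show "\<exists>a\<in>B2. \<exists>b\<in>B3. adj a b" using u3B adj_sym[OF w'(3)] by blast
    obtain w'' where w'': "w'' \<in> T1" "w'' \<noteq> v" "adj u1 w''"
      using face_other_nbr fv(1)[OF LF(1)[OF T1(1)]] T1(2) by metis
    then have "w'' \<in> B3" using adjD[OF w''(3)] T1(1) by (auto simp: B3_def)
    then show "\<exists>a\<in>B3. \<exists>b\<in>B1. adj a b" using b(1) adj_sym[OF w''(3)] by blast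
  qed
qed

text \<open>Besides \<open>v\<close> and its two neighbours a face has \<open>card S - 3\<close>
  vertices. There are as many neighbours as faces at \<open>v\<close>, so counting one neighbour per
  face turns this into \<open>card S - 2\<close>.\<close>

lemma card_Union_faces_at:
  assumes "v \<in> V"
  shows "card (\<Union>S\<in>faces_at v. S - {v}) \<le> (\<Sum>S\<in>faces_at v. card S - 2)"
proof -
  have sub: "(\<Union>S\<in>faces_at v. S - {v}) \<subseteq> nbrs v \<union> (\<Union>S\<in>faces_at v. S - {v} - nbrs v)" by auto
  have fin: "finite (\<Union>S\<in>faces_at v. S - {v} - nbrs v)"
    using face_facts(1) by (intro finite_subset[OF _ finV]) (auto simp: faces_at_def)
  have c: "1 + card (S - {v} - nbrs v) = card S - 2" if "S \<in> faces_at v" for S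
  proof -
    have S: "face S" "v \<in> S" "finite S" using that face_facts by (auto simp: faces_at_def)
    have "S - {v} - nbrs v = S - insert v (nbrs v \<inter> S)" by auto
    moreover have "card (insert v (nbrs v \<inter> S)) = 3"
      using S nbrs_subset(2)[of v] by (simp add: face_def)
    moreover have "insert v (nbrs v \<inter> S) \<subseteq> S" using S by auto
    ultimately have "card (S - {v} - nbrs v) = card S - 3"
      using S by (simp add: card_Diff_subset finite_subset)
    then show ?thesis using face_facts(3)[OF S(1)] by simp
  qed
  have "card (\<Union>S\<in>faces_at v. S - {v}) \<le> card (nbrs v \<union> (\<Union>S\<in>faces_at v. S - {v} - nbrs v))"
    using sub fin nbrs_subset(3) by (intro card_mono) auto
  also have "\<dots> \<le> card (nbrs v) + card (\<Union>S\<in>faces_at v. S - {v} - nbrs v)" by (rule card_Un_le)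
  also have "\<dots> \<le> card (faces_at v) + (\<Sum>S\<in>faces_at v. card (S - {v} - nbrs v))"
    unfolding card_faces_at by (intro add_left_mono card_UN_le finite_faces_at)
  also have "\<dots> = (\<Sum>S\<in>faces_at v. 1 + card (S - {v} - nbrs v))" by (subst sum.distrib) simp
  also have "\<dots> = (\<Sum>S\<in>faces_at v. card S - 2)" using c by (rule sum.cong[OF refl])
  finally show ?thesis .
qed

text \<open>With x = card S - 3, a face contributes 1/3 - 1/(card S) = x/(3(x + 3)), and x/(x + 3) is
  subadditive, so the worst case concentrates the excess in a single face.\<close>

lemma sum_inverse_face_le:
  assumes "v \<in> V" "D > 0" "D \<le> (\<Sum>S\<in>faces_at v. card S - 2)"
  shows "(\<Sum>S\<in>faces_at v. 1 / real (card S)) \<le> (real (card (nbrs v)) - 1) / 3 + real (card (nbrs v)) / (3 * real D)"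
proof -
  define d where "d = real (card (nbrs v))"
  define x where "x S = real (card S) - 3" for S :: "'a set"
  define X where "X = (\<Sum>S\<in>faces_at v. x S)"
  have ge3: "3 \<le> card S" if "S \<in> faces_at v" for S using that face_facts by (auto simp: faces_at_def)
  then have x0: "x S \<ge> 0" if "S \<in> faces_at v" for S using that by (force simp: x_def)
  have xX: "x S \<le> X" if "S \<in> faces_at v" for S
    unfolding X_def by (rule member_le_sum) (use that x0 finite_faces_at in auto)
  have X0: "X \<ge> 0" unfolding X_def using x0 by (rule sum_nonneg)
  have d3: "d \<ge> 3" using card_nbrs_ge_3[OF assms(1)] by (simp add: d_def)
  have cd: "real (card (faces_at v)) = d" by (simp only: d_def card_faces_at)
  have "real (\<Sum>S\<in>faces_at v. card S - 2) = (\<Sum>S\<in>faces_at v. x S + 1)"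
    unfolding of_nat_sum by (rule sum.cong) (use ge3 in \<open>force simp: x_def of_nat_diff\<close>)+
  also have "\<dots> = X + d" by (simp add: sum.distrib cd X_def)
  finally have XD: "X \<ge> real D - d" using assms(3) by linarith
  have "X / (3 * (X + 3)) = (\<Sum>S\<in>faces_at v. x S / (3 * (X + 3)))" by (simp add: X_def sum_divide_distrib)
  also have "\<dots> \<le> (\<Sum>S\<in>faces_at v. 1 / 3 - 1 / real (card S))"
  proof (rule sum_mono)
    fix S assume S: "S \<in> faces_at v"
    have "1 / 3 - 1 / real (card S) = x S / (3 * (x S + 3))"
      using ge3[OF S] by (simp add: x_def field_simps)
    moreover have "x S / (3 * (X + 3)) \<le> x S / (3 * (x S + 3))"
      using x0[OF S] xX[OF S] by (intro divide_left_mono) auto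
    ultimately show "x S / (3 * (X + 3)) \<le> 1 / 3 - 1 / real (card S)" by simp
  qed
  also have "\<dots> = d / 3 - (\<Sum>S\<in>faces_at v. 1 / real (card S))" by (simp add: sum_subtractf cd)
  finally have lower: "(\<Sum>S\<in>faces_at v. 1 / real (card S)) \<le> d / 3 - X / (3 * (X + 3))" by simp
  \<comment> \<open>From \<open>d \<ge> 3\<close> and \<open>X + d \<ge> D\<close> follows X/(X+3)
    \<ge> X/(X+d) \<ge> 1 - d/D. The result is linear in the degree \<open>d\<close> and can be
    summed over all vertices.\<close>
  have "(real D - d) / (3 * real D) \<le> X / (3 * (X + 3))"
  proof -
    have D: "real D > 0" using assms(2) by simp
    have "(real D - d) * (X + 3) \<le> X * real D"
    proof -
      have "3 * real D \<le> 3 * (X + d)" using XD by simp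
      also have "\<dots> \<le> d * X + 3 * d" using d3 X0 mult_right_mono[of 3 d X] by (simp add: algebra_simps)
      finally show ?thesis by (simp add: algebra_simps)
    qed
    then show ?thesis using D X0 by (simp add: divide_simps) (simp add: algebra_simps)
  qed
  moreover have "(real D - d) / (3 * real D) = 1 / 3 - d / (3 * real D)"
    using assms(2) by (simp add: diff_divide_distrib)
  moreover have "(d - 1) / 3 = d / 3 - 1 / 3" by (simp add: diff_divide_distrib)
  ultimately show ?thesis using lower unfolding d_def by linarith
qed

section \<open>Charging each face to its vertices\<close>

lemma sum_card_nbrs: "(\<Sum>v\<in>V. card (nbrs v)) = 2 * card E"
proof -
  have "card (nbrs v) = card {e \<in> E. v \<in> e}" for v
  proof (rule bij_betw_same_card[of "\<lambda>u. {v, u}"])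
    show "bij_betw (\<lambda>u. {v, u}) (nbrs v) {e \<in> E. v \<in> e}"
    proof (rule bij_betw_imageI)
      show "inj_on (\<lambda>u. {v, u}) (nbrs v)" by (rule inj_onI) (auto simp: doubleton_eq_iff)
      show "(\<lambda>u. {v, u}) ` nbrs v = {e \<in> E. v \<in> e}"
      proof (intro equalityI subsetI)
        fix e assume "e \<in> {e \<in> E. v \<in> e}"
        then obtain a b where "e = {a, b}" "adj a b" "v = a \<or> v = b" by (auto elim: edgeE)
        then have "\<exists>u. e = {v, u} \<and> adj v u" using adj_sym by blast
        then show "e \<in> (\<lambda>u. {v, u}) ` nbrs v" by (auto simp: nbrs_def)
      qed (auto simp: nbrs_def)
    qed
  qed
  then have "(\<Sum>v\<in>V. card (nbrs v)) = (\<Sum>v\<in>V. card {e \<in> E. v \<in> e})" by simp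
  also have "\<dots> = (\<Sum>e\<in>E. 2)"
  proof (rule sum_multicount_gen)
    have "{v \<in> V. v \<in> e} = e" if "e \<in> E" for e using edge[OF that] by auto
    then show "\<forall>e\<in>E. card {v \<in> V. v \<in> e} = 2" using edge by simp
  qed (use finV finE in auto)
  finally show ?thesis by simp
qed

text \<open>Every face spreads one unit evenly over its vertices.\<close>

lemma sum_inverse_faces: "(\<Sum>v\<in>V. \<Sum>S\<in>faces_at v. 1 / real (card S)) = real (card {S. face S})"
proof -
  have "(\<Sum>v\<in>V. \<Sum>S\<in>faces_at v. 1 / real (card S)) =
      (\<Sum>v\<in>V. \<Sum>S\<in>{S. face S}. if v \<in> S then 1 / real (card S) else 0)"
  proof (rule sum.cong[OF refl])
    fix v
    have "faces_at v = {S. face S} \<inter> {S. v \<in> S}" by (auto simp: faces_at_def)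
    then show "(\<Sum>S\<in>faces_at v. 1 / real (card S)) =
        (\<Sum>S\<in>{S. face S}. if v \<in> S then 1 / real (card S) else 0)"
      using sum.inter_restrict[OF finite_faces, of "\<lambda>S. 1 / real (card S)" "{S. v \<in> S}"] by simp
  qed
  also have "\<dots> = (\<Sum>S\<in>{S. face S}. \<Sum>v\<in>V. if v \<in> S then 1 / real (card S) else 0)" by (rule sum.swap)
  also have "\<dots> = (\<Sum>S\<in>{S. face S}. 1)"
  proof (rule sum.cong[OF refl])
    fix S assume "S \<in> {S. face S}"
    then have S: "S \<subseteq> V" "card S \<ge> 3" using face_facts by auto
    have "(\<Sum>v\<in>V. if v \<in> S then 1 / real (card S) else 0) = (\<Sum>v\<in>V \<inter> S. 1 / real (card S))"
      using sum.inter_restrict[OF finV, of "\<lambda>v. 1 / real (card S)" S] by simp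
    then show "(\<Sum>v\<in>V. if v \<in> S then 1 / real (card S) else 0) = 1" using S by (auto simp: Int_absorb1)
  qed
  finally show ?thesis by simp
qed

lemma small_wheel:
  assumes "\<epsilon> > 0" "2 * real (card E) \<ge> (4 + \<epsilon>) * real (card V)" "real T \<ge> 8 / \<epsilon>"
  obtains v where "v \<in> V" "(\<Sum>S\<in>faces_at v. card S - 2) < T + 2"
proof -
  define D where "D = real (T + 2)"
  define m n where "m = real (card E)" and "n = real (card V)"
  have n: "n > 0" using cardV by (simp add: n_def)
  have T0: "real T > 0" using assms by (meson divide_pos_pos less_le_trans zero_less_numeral)
  have "\<exists>v\<in>V. (\<Sum>S\<in>faces_at v. card S - 2) < T + 2"
  proof (rule ccontr)
    assume "\<not> ?thesis"
    then have big: "T + 2 \<le> (\<Sum>S\<in>faces_at v. card S - 2)" if "v \<in> V" for v using that by force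
    have "real (card {S. face S}) \<le> (\<Sum>v\<in>V. (real (card (nbrs v)) - 1) / 3 + real (card (nbrs v)) / (3 * D))"
      unfolding sum_inverse_faces[symmetric] D_def
    proof (rule sum_mono)
      fix v assume "v \<in> V"
      from sum_inverse_face_le[OF this _ big[OF this]]
      show "(\<Sum>S\<in>faces_at v. 1 / real (card S)) \<le>
          (real (card (nbrs v)) - 1) / 3 + real (card (nbrs v)) / (3 * real (T + 2))" by simp
    qed
    also have "\<dots> = (\<Sum>v\<in>V. real (card (nbrs v)) * (1 / 3 + 1 / (3 * D)) - 1 / 3)"
      by (rule sum.cong) (auto simp: field_simps)
    also have "\<dots> = (\<Sum>v\<in>V. real (card (nbrs v))) * (1 / 3 + 1 / (3 * D)) - n / 3"
      by (simp add: sum_subtractf sum_distrib_right n_def)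
    also have "(\<Sum>v\<in>V. real (card (nbrs v))) = 2 * m"
      using arg_cong[OF sum_card_nbrs, of real] by (simp add: m_def)
    finally have up: "real (card {S. face S}) \<le> 2 * m * (1 / 3 + 1 / (3 * D)) - n / 3" .
    have "m + 1 \<le> real (card {S. face S}) + n"
      using edges_le_faces unfolding m_def n_def by linarith
    with up have "m + 1 \<le> 2 * m * (1 / 3 + 1 / (3 * D)) - n / 3 + n" by linarith
    then have "3 * D * (m + 1) \<le> 3 * D * (2 * m * (1 / 3 + 1 / (3 * D)) - n / 3 + n)"
      by (rule mult_left_mono) (simp add: D_def)
    also have "\<dots> = 2 * m * (D + 1) + 2 * D * n" by (simp add: D_def field_simps)
    \<comment> \<open>Here \<open>D = T + 2\<close> pays off: 3Dm - 2m(D+1) = m(D-2) = mT.\<close>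
    finally have *: "m * real T + 3 * D \<le> 2 * D * n" by (simp add: D_def algebra_simps)
    \<comment> \<open>This is where \<open>8 \<le> \<epsilon> * T\<close> enters; it absorbs the 8n
      that remains of 4Dn = 4nT + 8n.\<close>
    have "4 * n * real T + 8 * n \<le> 4 * n * real T + \<epsilon> * real T * n"
      using assms(1,3) n by (simp add: pos_divide_le_eq mult.commute)
    also have "\<dots> = ((4 + \<epsilon>) * n) * real T" by (simp add: algebra_simps)
    also have "\<dots> \<le> 2 * m * real T" using assms(2) by (simp add: m_def n_def mult_right_mono)
    finally show False using * T0 by (simp add: D_def algebra_simps)
  qed
  then show ?thesis using that by blast
qed

end

section \<open>Transfer to the graph notions of the statement\<close>

lemma (in sgraph) conn_subgraph:
  assumes "conn B" "B \<subseteq> V"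
  shows "is_subgraph \<lparr>gverts = B, gedges = {e \<in> E. e \<subseteq> B}\<rparr> \<lparr>gverts = V, gedges = E\<rparr>"
    and "connected_graph \<lparr>gverts = B, gedges = {e \<in> E. e \<subseteq> B}\<rparr>"
proof -
  show "is_subgraph \<lparr>gverts = B, gedges = {e \<in> E. e \<subseteq> B}\<rparr> \<lparr>gverts = V, gedges = E\<rparr>"
    using assms(2) edge finV finite_subset by (auto simp: is_subgraph_def fin_simple_graph_def)
  have "adj_rel \<lparr>gverts = B, gedges = {e \<in> E. e \<subseteq> B}\<rparr> = adj_in B"
    by (auto simp: adj_rel_def adj_in_def)
  then show "connected_graph \<lparr>gverts = B, gedges = {e \<in> E. e \<subseteq> B}\<rparr>"
    using assms(1) by (simp add: connected_graph_def conn_def)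
qed

theorem theorem5p7:
  fixes \<epsilon> :: real and G :: "'a ugraph"
  assumes "0 < \<epsilon>" and "\<epsilon> < 2"
    and "fin_simple_graph G"
    and "k_connected 3 G"
    and "planar_graph G"
    and "avg_degree G \<ge> 4 + \<epsilon>"
  shows "\<exists>B. clique_model 4 G B \<and> int (model_size 4 B) \<le> 2 + \<lceil>8 / \<epsilon>\<rceil>"
proof -
  define V where "V = gverts G"
  define E where "E = gedges G"
  have G: "G = \<lparr>gverts = V, gedges = E\<rparr>" by (simp add: V_def E_def)
  interpret sgraph V E
    using assms(3) by unfold_locales (auto simp: fin_simple_graph_def V_def E_def)
  have cn: "conn (V - X)" if "connected_graph (remove_verts G X)" for X
  proof -
    have "adj_rel (remove_verts G X) = adj_in (V - X)"
      using edge by (force simp: adj_rel_def adj_in_def remove_verts_def E_def[symmetric])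
    then show ?thesis using that
      by (simp add: connected_graph_def conn_def remove_verts_def V_def)
  qed
  obtain p \<gamma> where draw: "plane_drawing G p \<gamma>" using assms(5) by (auto simp: planar_graph_def)
  interpret plane_graph V E p \<gamma>
  proof unfold_locales
    show "conn (V - X)" if "X \<subseteq> V" "card X < 3" for X
      using assms(4) cn that unfolding k_connected_def V_def by blast
    show "3 < card V" using assms(4) by (simp add: k_connected_def V_def)
    show "plane_drawing \<lparr>gverts = V, gedges = E\<rparr> p \<gamma>" using draw G by simp
  qed
  define T where "T = nat \<lceil>8 / \<epsilon>\<rceil>"
  have T: "int T = \<lceil>8 / \<epsilon>\<rceil>" "8 / \<epsilon> \<le> real T"
  proof -
    have "0 < 8 / \<epsilon>" using assms(1) by simp
    then have "0 \<le> \<lceil>8 / \<epsilon>\<rceil>" by linarith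
    then show "int T = \<lceil>8 / \<epsilon>\<rceil>" by (simp add: T_def)
    then show "8 / \<epsilon> \<le> real T" by (metis le_of_int_ceiling of_int_of_nat_eq)
  qed
  have "(4 + \<epsilon>) * real (card V) \<le> 2 * real (card E)"
    using assms(6) cardV by (simp add: avg_degree_def V_def E_def le_divide_eq)
  then obtain v where v: "v \<in> V" "(\<Sum>S\<in>faces_at v. card S - 2) < T + 2"
    using small_wheel assms(1) T(2) by metis
  obtain B1 B2 B3 where B: "conn B1" "conn B2" "conn B3" "v \<notin> B1 \<union> B2 \<union> B3"
    "B1 \<inter> B2 = {}" "B1 \<inter> B3 = {}" "B2 \<inter> B3 = {}"
    "B1 \<union> B2 \<union> B3 \<subseteq> (\<Union>S\<in>faces_at v. S - {v})"
    "\<exists>b\<in>B1. adj v b" "\<exists>b\<in>B2. adj v b" "\<exists>b\<in>B3. adj v b"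
    "\<exists>a\<in>B1. \<exists>b\<in>B2. adj a b" "\<exists>a\<in>B2. \<exists>b\<in>B3. adj a b" "\<exists>a\<in>B3. \<exists>b\<in>B1. adj a b"
    by (rule wheel_model[OF v(1)])
  have UV: "(\<Union>S\<in>faces_at v. S - {v}) \<subseteq> V" using face_facts(1) by (auto simp: faces_at_def)
  have BV: "B1 \<subseteq> V" "B2 \<subseteq> V" "B3 \<subseteq> V" using B(8) UV by auto
  have fin: "finite B1" "finite B2" "finite B3" using BV finV finite_subset by metis+
  define H where "H X = \<lparr>gverts = X, gedges = {e \<in> E. e \<subseteq> X}\<rparr>" for X
  define Bs where "Bs = [{v}, B1, B2, B3]"
  define B where "B i = H (Bs ! i)" for i
  have lt4: "i = 0 \<or> i = 1 \<or> i = 2 \<or> i = 3" if "i < 4" for i :: nat using that by auto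
  have each: "is_subgraph (H X) G \<and> connected_graph (H X)" if "X \<in> set Bs" for X
  proof -
    have "conn X" "X \<subseteq> V" using that B(1-3) BV v(1) conn_singleton by (auto simp: Bs_def)
    then show ?thesis using conn_subgraph G by (simp add: H_def)
  qed
  \<comment> \<open>Being symmetric, this relation reduces the twelve ordered pairs of branch sets
    to six.\<close>
  define touch where "touch X Y \<longleftrightarrow> X \<inter> Y = {} \<and> (\<exists>a\<in>X. \<exists>b\<in>Y. adj a b)" for X Y
  have touch: "touch {v} B1" "touch {v} B2" "touch {v} B3" "touch B1 B2" "touch B2 B3" "touch B3 B1"
    using B(4-7,9-14) by (auto simp: touch_def)
  have sym: "touch Y X" if "touch X Y" for X Y
    using that adj_sym unfolding touch_def by blast
  have "clique_model 4 G B"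
    unfolding clique_model_def
  proof (intro conjI allI impI)
    fix i :: nat assume "i < 4"
    then have "Bs ! i \<in> set Bs" by (intro nth_mem) (simp add: Bs_def)
    then show "is_subgraph (B i) G" "connected_graph (B i)"
      using each by (simp_all add: B_def)
  next
    fix i j :: nat assume ij: "i < 4" "j < 4" "i \<noteq> j"
    have "touch (Bs ! i) (Bs ! j)"
      using lt4[OF ij(1)] lt4[OF ij(2)] ij(3)
      by (elim disjE) (simp_all add: Bs_def touch sym[OF touch(1)] sym[OF touch(2)] sym[OF touch(3)]
        sym[OF touch(4)] sym[OF touch(5)] sym[OF touch(6)])
    then show "gverts (B i) \<inter> gverts (B j) = {}"
      and "\<exists>u\<in>gverts (B i). \<exists>w\<in>gverts (B j). (u, w) \<in> adj_rel G"
      by (auto simp: touch_def B_def H_def adj_rel_def E_def)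
  qed
  \<comment> \<open>The strict bound leaves at most \<open>T + 1\<close> vertices on the rim; the
    hub is the remaining one.\<close>
  moreover have "model_size 4 B \<le> T + 2"
  proof -
    have "model_size 4 B = 1 + (card B1 + card B2 + card B3)"
      by (simp add: model_size_def B_def Bs_def H_def numeral_eq_Suc)
    also have "card B1 + card B2 + card B3 = card (B1 \<union> B2 \<union> B3)"
      using fin B(5-7) by (simp add: card_Un_disjoint Int_Un_distrib2)
    also have "\<dots> \<le> card (\<Union>S\<in>faces_at v. S - {v})"
      by (rule card_mono[OF finite_subset[OF UV finV] B(8)])
    also have "\<dots> \<le> (\<Sum>S\<in>faces_at v. card S - 2)" by (rule card_Union_faces_at[OF v(1)])
    finally show ?thesis using v(2) by simp
  qed
  ultimately show ?thesis using T(1) by (intro exI[of _ B]) auto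
qed

end
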